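(* Let $r\ge 2$ and let $t_i\ge 2$ $(1\le i\le r)$ be fixed integers. Then for every $\varepsilon>0$, $$\sum_{\substack{n_1,\ldots,n_r\le x \\ \gcd(n_i,n_j)=1 \, (i\ne j)}} \tau_{t_1}(n_1) \cdots \tau_{t_r}(n_r) = x^r \overline{Q}(\log x)+ O\bigl(x^{r-1+\max_{1\le i\le r} \vartheta_{t_i} +\varepsilon}\bigr),$$ where $\overline{Q}(u)$ is a polynomial in $u$ of degree $t_1+\cdots+t_r-r$ having the leading coefficient $$\frac{\overline{\Delta}(\tau_{t_1},\ldots,\tau_{t_r},1,\ldots,1)}{(t_1-1)!\cdots (t_r-1)!},$$ with $$\overline{\Delta}(\tau_{t_1},\ldots,\tau_{t_r},1,\ldots,1)=\prod_p \biggl(1- \sum_{i=2}^r (i-1) \sum_{1\le \ell_1<\cdots <\ell_i\le r}\ \sum_{a_{\ell_1},\ldots,a_{\ell_i}=1}^t \frac1{p^{a_{\ell_1}+\cdots +a_{\ell_i}}} \prod_{m=1}^i (-1)^{a_{\ell_m}} \binom{t_{\ell_m}}{a_{\ell_m}}\biggr),\qquad t=\max_{1\le i\le r}t_i,$$ the product being over all primes $p$.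
   Context: $\tau_t(n)=\sum_{d_1\cdots d_t=n}1$ is the Piltz divisor function of order $t$ (the number of ordered $t$-tuples of positive integers with product $n$). $\binom{a}{b}=0$ if $b>a$. $\vartheta_{t_i}$ is the exponent in the Piltz divisor problem for $\tau_{t_i}$, namely a real number such that for every $\varepsilon>0$, $\sum_{n\le x}\tau_{t_i}(n)=xP_{t_i}(\log x)+O(x^{\vartheta_{t_i}+\varepsilon})$, with some polynomial $P_{t_i}(u)$ in $u$ of degree $t_i-1$ having leading coefficient $1/(t_i-1)!$. Asymptotics are as $x\to\infty$; implied constants may depend on $r$, the $t_i$ and $\varepsilon$. The sum is over $r$-tuples of pairwise relatively prime positive integers. *)

theory Defs
  imports
    "HOL-Analysis.Analysis"
    "HOL-Library.Landau_Symbols"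
    "HOL-Computational_Algebra.Polynomial"
    "HOL-Computational_Algebra.Primes"
begin

definition piltz :: "nat \<Rightarrow> nat \<Rightarrow> nat" where
  "piltz t n = card {ds :: nat list. length ds = t \<and> (\<forall>d \<in> set ds. d > 0) \<and> prod_list ds = n}"

(* No optimality of \<theta> is required: any real number for which the estimate holds is admitted.
   The polynomial is chosen before \<epsilon>. *)
definition piltz_exponent :: "nat \<Rightarrow> real \<Rightarrow> bool" where
  "piltz_exponent t \<theta> \<longleftrightarrow>
     (\<exists>P :: real poly. degree P = t - 1 \<and> lead_coeff P = 1 / fact (t - 1) \<and>
       (\<forall>\<epsilon>>0. (\<lambda>x. (\<Sum>n\<in>{1..nat \<lfloor>x\<rfloor>}. real (piltz t n)) - x * poly P (ln x))
                 \<in> O[at_top](\<lambda>x. x powr (\<theta> + \<epsilon>))))"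

definition coprime_tuples :: "nat \<Rightarrow> real \<Rightarrow> (nat \<Rightarrow> nat) set" where
  "coprime_tuples r x =
     {n \<in> {1..r} \<rightarrow>\<^sub>E {1..nat \<lfloor>x\<rfloor>}. pairwise (\<lambda>i j. coprime (n i) (n j)) {1..r}}"

(* An increasing index tuple l_1 < ... < l_i in {1..r} is the set L of its entries, card L = i;
   the exponents a_(l_1), ..., a_(l_i) are an extensional function on L. *)
definition Delta_factor :: "nat \<Rightarrow> (nat \<Rightarrow> nat) \<Rightarrow> nat \<Rightarrow> real" where
  "Delta_factor r t p =
     1 - (\<Sum>i=2..r. (real i - 1) *
           (\<Sum>L\<in>{L. L \<subseteq> {1..r} \<and> card L = i}.
             \<Sum>a\<in>L \<rightarrow>\<^sub>E {1..Max (t ` {1..r})}.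
               1 / real p ^ (\<Sum>l\<in>L. a l) * (\<Prod>l\<in>L. (- 1) ^ a l * real (t l choose a l))))"

(* Factors at non-primes are 1, so this infinite product over nat runs over the primes
   in increasing order. *)
definition Delta_seq :: "nat \<Rightarrow> (nat \<Rightarrow> nat) \<Rightarrow> nat \<Rightarrow> real" where
  "Delta_seq r t p = (if prime p then Delta_factor r t p else 1)"

definition Delta :: "nat \<Rightarrow> (nat \<Rightarrow> nat) \<Rightarrow> real" where
  "Delta r t = (\<Prod>p. Delta_seq r t p)"

end

theory Submission
  imports Defs
begin

text \<open>
  The multiple Dirichlet series of the coprime sum is $\prod_i \zeta(s_i)^{t_i}$ times an Euler
  product whose coefficients are supported on tuples in which every occurring prime divides at
  least two entries. Hence the coprime sum is a combination, with coefficients $h(d)$, of products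
  $\prod_i S_{t_i}(x/d_i)$ of Piltz sums, and $\sum_d |h(d)| \prod_i d_i^{-s_i}$ converges as soon
  as $s_i \ge 0$ and $s_i + s_j > 1$ for all $i \ne j$. Replacing the factors one at a time by
  $y P_{t_i}(\log y)$, the replacement at position $i$ costs
  $x^{r-1+\vartheta+O(\varepsilon)} d_i^{-\vartheta-2\varepsilon} \prod_{j\ne i} d_j^{-1+\varepsilon}$,
  which is summable because $\vartheta \ge 0$. All sums over $d$ are restricted to the primes below
  $n$, where they are finite and the identity is exact for $n > x$; the estimates are uniform in
  $n$, so only the finitely many coefficients of the main term need a limit. When
  $\max\vartheta_{t_i} \ge 1$ the error term absorbs the whole sum.
\<close>

section \<open>Removing an Euler factor from the Piltz functions\<close>

text \<open>The d_i are unbounded, so the Piltz estimates are needed at y = x/d_i for every y > 0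
  and not only for large y. For y < 1 the Piltz sum is 0 but y P(log y) is not, and log-polynomials
  obey only a two-sided bound y^\<epsilon> + y^(-\<epsilon>). This is why y^(1-\<epsilon>)
  accompanies y^(1+\<epsilon>) and why the unreplaced factors contribute d_j^(-1+\<epsilon>). With
  weight exponent \<theta> + 2\<epsilon> at position i and 1 - \<epsilon> elsewhere, the pairwise
  sums are 1 + \<theta> + \<epsilon> and 2 - 2\<epsilon>; a convergence margin of \<epsilon> then
  asks for \<theta> >= 0 and \<epsilon> <= 1/3. The degree claim needs a nonzero leading
  coefficient. With u_i = (1 - 1/p)^(t_i), the factor at p is the product of the u_i plus terms (1 -
  u_l) times the product of the other u_i, hence positive, and a convergent product without
  vanishing factor is nonzero. The same fact supplies a polynomial of the right degree when the
  error term absorbs everything.\<close>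

lemma piltz_eq_0_at_0 [simp]: "piltz t 0 = 0"
proof -
  have "{ds :: nat list. length ds = t \<and> (\<forall>d \<in> set ds. d > 0) \<and> prod_list ds = 0} = {}"
    by (auto simp: prod_list_zero_iff)
  then show ?thesis unfolding piltz_def by (simp only: card.empty)
qed

lemma piltz_order_0: "piltz 0 m = (if m = 1 then 1 else 0)"
proof -
  have "{ds :: nat list. length ds = 0 \<and> (\<forall>d \<in> set ds. d > 0) \<and> prod_list ds = m}
      = (if m = 1 then {[]} else {})"
    by auto
  then show ?thesis by (simp add: piltz_def)
qed

lemma finite_factorizations:
  assumes "m > 0"
  shows "finite {ds :: nat list. length ds = t \<and> (\<forall>d \<in> set ds. d > 0) \<and> prod_list ds = m}"
proof (rule finite_subset)
  show "{ds :: nat list. length ds = t \<and> (\<forall>d \<in> set ds. d > 0) \<and> prod_list ds = m}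
      \<subseteq> {ds. set ds \<subseteq> {..m} \<and> length ds = t}"
  proof -
    have "d \<le> prod_list ds" if "d \<in> set ds" "prod_list ds > 0" for ds :: "nat list" and d
      using that
    proof (induction ds)
      case (Cons a ds)
      then have "1 * d \<le> a * prod_list ds" if "d \<noteq> a" using that by (intro mult_le_mono) auto
      with Cons show ?case by (cases "d = a") auto
    qed simp
    then show ?thesis using assms by auto
  qed
  show "finite {ds. set ds \<subseteq> {..m} \<and> length ds = t}"
    using finite_lists_length_eq[of "{..m}" t] by simp
qed

lemma piltz_Suc:
  assumes "m > 0"
  shows "piltz (Suc t) m = (\<Sum>d | d dvd m. piltz t (m div d))"
proof -
  let ?F = "\<lambda>t m. {ds :: nat list. length ds = t \<and> (\<forall>d \<in> set ds. d > 0) \<and> prod_list ds = m}"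
  have eq: "?F (Suc t) m = (\<Union>d\<in>{d. d dvd m}. Cons d ` ?F t (m div d))"
  proof (intro set_eqI iffI)
    fix ds assume ds: "ds \<in> ?F (Suc t) m"
    then obtain d ds' where eq: "ds = d # ds'" by (cases ds) auto
    have "m div d = prod_list ds'" "d dvd m" using ds by (auto simp: eq)
    then have "ds' \<in> ?F t (m div d)" using ds by (simp add: eq)
    with \<open>d dvd m\<close> show "ds \<in> (\<Union>d\<in>{d. d dvd m}. Cons d ` ?F t (m div d))"
      unfolding eq by blast
  next
    fix ds assume "ds \<in> (\<Union>d\<in>{d. d dvd m}. Cons d ` ?F t (m div d))"
    then show "ds \<in> ?F (Suc t) m" using assms by (auto intro!: Nat.gr0I)
  qed
  have "card (?F (Suc t) m) = (\<Sum>d | d dvd m. card (Cons d ` ?F t (m div d)))"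
    unfolding eq
  proof (rule card_UN_disjoint)
    show "finite {d. d dvd m}" using assms by simp
    show "\<forall>d\<in>{d. d dvd m}. finite (Cons d ` ?F t (m div d))"
      using assms by (auto intro!: finite_imageI finite_factorizations simp: dvd_div_eq_0_iff)
  qed auto
  also have "\<dots> = (\<Sum>d | d dvd m. card (?F t (m div d)))"
    by (intro sum.cong refl card_image) (simp add: inj_on_def)
  finally show ?thesis by (simp add: piltz_def)
qed

lemma piltz_pos:
  assumes "t > 0" "m > 0"
  shows "piltz t m > 0"
proof -
  have "m # replicate (t - 1) 1
      \<in> {ds :: nat list. length ds = t \<and> (\<forall>d \<in> set ds. d > 0) \<and> prod_list ds = m}"
    using assms by auto
  then show ?thesis
    unfolding piltz_def card_gt_0_iff using finite_factorizations[OF assms(2)] by blast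
qed

section \<open>Multiplication by 1 - p^(-s) on coefficients\<close>

definition pdiff :: "nat \<Rightarrow> (nat \<Rightarrow> real) \<Rightarrow> nat \<Rightarrow> real" where
  "pdiff p f m = f m - (if p dvd m then f (m div p) else 0)"

text \<open>On Dirichlet series, \<open>pdiff p\<close> is multiplication by 1 - p^(-s) and
  \<open>pconv p\<close> is multiplication by zeta(s)(1 - p^(-s)), the sum over d prime to
  p.\<close>

definition pconv :: "nat \<Rightarrow> (nat \<Rightarrow> real) \<Rightarrow> nat \<Rightarrow> real" where
  "pconv p f m = (\<Sum>d | d dvd m \<and> \<not> p dvd d. f (m div d))"

text \<open>The binomial expansion of (1 - p^(-s)) to a power. Peeling off the innermost difference
  turns each term into a difference of consecutive ones, and Pascal's rule recombines them.\<close>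

lemma pdiff_funpow:
  assumes "p > 0"
  shows "(pdiff p ^^ s) f m =
    (\<Sum>a\<le>s. (-1) ^ a * real (s choose a) * (if p ^ a dvd m then f (m div p ^ a) else 0))"
proof (induction s arbitrary: f)
  case (Suc s)
  let ?g = "\<lambda>a. if p ^ a dvd m then f (m div p ^ a) else 0"
  have step: "(if p ^ a dvd m then pdiff p f (m div p ^ a) else 0) = ?g a - ?g (Suc a)" for a
  proof (cases "p ^ a dvd m")
    case True
    then have "p dvd m div p ^ a \<longleftrightarrow> p ^ Suc a dvd m"
      using assms by (simp add: dvd_div_iff_mult mult.commute)
    moreover have "m div p ^ a div p = m div p ^ Suc a"
      by (simp add: div_mult2_eq[symmetric] mult.commute)
    ultimately show ?thesis using True by (simp add: pdiff_def)
  next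
    case False
    then have "\<not> p ^ Suc a dvd m" by (metis dvd_mult_right power_Suc)
    with False show ?thesis by simp
  qed
  have "(pdiff p ^^ Suc s) f m = (pdiff p ^^ s) (pdiff p f) m"
    by (simp add: funpow_Suc_right del: funpow.simps)
  also have "\<dots> = (\<Sum>a\<le>s. (-1) ^ a * real (s choose a) * ?g a)
      - (\<Sum>a\<le>s. (-1) ^ a * real (s choose a) * ?g (Suc a))"
    unfolding Suc.IH step by (simp add: sum_subtractf algebra_simps)
  also have "(\<Sum>a\<le>s. (-1) ^ a * real (s choose a) * ?g a)
      = (\<Sum>a\<le>Suc s. (-1) ^ a * real (s choose a) * ?g a)"
    unfolding sum.atMost_Suc by (simp only: binomial_eq_0 lessI of_nat_0 mult_zero_right mult_zero_left add_0_right)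
  also have "\<dots> = ?g 0 + (\<Sum>a\<le>s. (-1) ^ Suc a * real (s choose Suc a) * ?g (Suc a))"
    unfolding sum.atMost_Suc_shift by (simp only: power_0 binomial_n_0 of_nat_1 mult_1)
  also have "\<dots> - (\<Sum>a\<le>s. (-1) ^ a * real (s choose a) * ?g (Suc a))
      = ?g 0 + (\<Sum>a\<le>s. (-1) ^ Suc a * real (Suc s choose Suc a) * ?g (Suc a))"
    unfolding add_diff_eq[symmetric] sum_subtractf[symmetric] binomial_Suc_Suc of_nat_add
    by (intro arg_cong2[where f = "(+)"] sum.cong refl) (simp only: power_Suc ring_distribs mult_minus_left mult_1_left minus_add_distrib diff_conv_add_uminus add.commute)
  also have "\<dots> = (\<Sum>a\<le>Suc s. (-1) ^ a * real (Suc s choose a) * ?g a)"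
    unfolding sum.atMost_Suc_shift by (simp only: power_0 binomial_n_0 of_nat_1 mult_1)
  finally show ?case .
qed (simp add: assms)

text \<open>Both operators multiply the Dirichlet series, so they commute. Concretely, for d
  dividing m and prime to p, p divides m/d exactly when it divides m.\<close>

lemma pdiff_pconv:
  assumes "prime p"
  shows "pdiff p (pconv p f) = pconv p (pdiff p f)"
proof
  fix m
  show "pdiff p (pconv p f) m = pconv p (pdiff p f) m"
  proof (cases "m = 0")
    case True
    \<comment> \<open>Every d divides 0, so the sum in \<open>pconv\<close> at m = 0 has an infinite
      index set and is 0 by convention.\<close>
    have inf: "infinite {d. \<not> p dvd d}"
    proof
      assume "finite {d. \<not> p dvd d}"
      then have "finite ((\<lambda>k. k * p + 1) ` UNIV)"
        proof (rule rev_finite_subset, clarify)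
        fix k assume "p dvd k * p + 1"
        then have "p dvd 1" by (subst (asm) dvd_add_right_iff) simp_all
        with assms show False by (simp add: prime_nat_iff)
      qed
      moreover have "inj (\<lambda>k. k * p + 1)" using prime_gt_0_nat[OF assms] by (auto simp: inj_def)
      ultimately show False by (simp add: finite_image_iff)
    qed
    then show ?thesis by (simp add: True pconv_def pdiff_def)
  next
    case False
    have "(if p dvd m then pconv p f (m div p) else 0)
        = (\<Sum>d | d dvd m \<and> \<not> p dvd d. if p dvd m div d then f (m div d div p) else 0)"
    proof (cases "p dvd m")
      case True
      have *: "d dvd m div p \<longleftrightarrow> d dvd m" and **: "d dvd m \<Longrightarrow> p dvd m div d" if "\<not> p dvd d" for d
      proof -
        have "coprime p d" using that assms by (simp add: prime_imp_coprime)
        show "d dvd m div p \<longleftrightarrow> d dvd m"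
          using True \<open>coprime p d\<close>
          by (metis coprime_commute coprime_dvd_mult_right_iff dvd_mult_div_cancel dvd_mult)
        show "p dvd m div d" if "d dvd m"
          using True \<open>coprime p d\<close> that by (metis coprime_dvd_mult_right_iff dvd_mult_div_cancel)
      qed
      have "pconv p f (m div p) = (\<Sum>d | d dvd m \<and> \<not> p dvd d. f (m div p div d))"
        unfolding pconv_def using * by (intro sum.cong) auto
      also have "\<dots> = (\<Sum>d | d dvd m \<and> \<not> p dvd d. if p dvd m div d then f (m div d div p) else 0)"
        using ** by (intro sum.cong refl) (simp add: div_mult2_eq[symmetric] mult.commute)
      finally show ?thesis using True by simp
    next
      case False
      have "\<not> p dvd m div d" if "d dvd m" for d
        using False that by (metis dvd_mult dvd_mult_div_cancel)
      then show ?thesis using False by simp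
    qed
    then show ?thesis by (simp add: pdiff_def[abs_def] pconv_def sum_subtractf)
  qed
qed

lemma pdiff_funpow_pconv:
  "prime p \<Longrightarrow> (pdiff p ^^ s) (pconv p f) = pconv p ((pdiff p ^^ s) f)"
  by (induction s) (simp_all add: pdiff_pconv)

text \<open>zeta^(t+1) (1 - p^(-s)) = zeta^t * zeta (1 - p^(-s)). In the divisor sum for order t + 1
  the divisors d = p e, with e dividing m/p, make up the value at m/p, which the difference
  cancels.\<close>

lemma pdiff_piltz_Suc:
  assumes "prime p"
  shows "pdiff p (\<lambda>m. real (piltz (Suc t) m)) = pconv p (\<lambda>m. real (piltz t m))"
proof
  fix m
  show "pdiff p (\<lambda>m. real (piltz (Suc t) m)) m = pconv p (\<lambda>m. real (piltz t m)) m"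
  proof (cases "m = 0")
    case True
    then show ?thesis by (simp add: pdiff_def pconv_def)
  next
    case False
    then have m: "m > 0" by simp
    have "real (piltz (Suc t) m)
        = (\<Sum>d | d dvd m \<and> \<not> p dvd d. real (piltz t (m div d))) + (\<Sum>d | d dvd m \<and> p dvd d. real (piltz t (m div d)))"
      unfolding piltz_Suc[OF m] of_nat_sum
      by (subst sum.union_disjoint[symmetric]) (use m in \<open>auto intro!: sum.cong intro: finite_subset[of _ "{d. d dvd m}"]\<close>)
    also have "(\<Sum>d | d dvd m \<and> p dvd d. real (piltz t (m div d)))
        = (if p dvd m then real (piltz (Suc t) (m div p)) else 0)"
    proof (cases "p dvd m")
      case True
      then have mp: "m div p > 0" using m by (auto simp: dvd_div_eq_0_iff)
      have p0: "p > 0" using assms by (simp add: prime_gt_0_nat)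
      have "(\<Sum>d | d dvd m \<and> p dvd d. real (piltz t (m div d)))
          = (\<Sum>e | e dvd m div p. real (piltz t (m div p div e)))"
      proof (rule sum.reindex_bij_witness[of _ "\<lambda>e. p * e" "\<lambda>d. d div p"])
        fix e assume e: "e \<in> {e. e dvd m div p}"
        then show "p * e \<in> {d. d dvd m \<and> p dvd d}"
          using True by (metis dvd_mult_div_cancel dvd_triv_left mem_Collect_eq mult_dvd_mono dvd_refl)
      qed (use True p0 in \<open>auto simp: div_dvd_div div_mult2_eq[symmetric]\<close>)
      then show ?thesis using True by (simp add: piltz_Suc[OF mp])
    next
      case False
      then have eq: "{d. d dvd m \<and> p dvd d} = {}" by (auto dest: dvd_trans)
      show ?thesis using False unfolding eq by simp
    qed
    finally show ?thesis by (simp add: pdiff_def pconv_def)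
  qed
qed

text \<open>The Euler factor of $\zeta(s)^t$ at $p$ is removed by multiplying with $(1-p^{-s})^t$.\<close>

lemma pdiff_funpow_piltz:
  assumes "prime p"
  shows "(pdiff p ^^ t) (\<lambda>m. real (piltz t m)) m = (if p dvd m then 0 else real (piltz t m))"
proof (induction t arbitrary: m)
  case 0
  then show ?case using assms by (auto simp: piltz_order_0)
next
  case (Suc t)
  \<comment> \<open>The innermost difference lowers the order by one at the price of
    \<open>pconv p\<close>; the other t differences pass through \<open>pconv p\<close> and meet the
    induction hypothesis.\<close>
  have "(pdiff p ^^ Suc t) (\<lambda>m. real (piltz (Suc t) m)) m
      = (pdiff p ^^ t) (pdiff p (\<lambda>m. real (piltz (Suc t) m))) m"
    by (simp add: funpow_Suc_right del: funpow.simps)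
  also have "\<dots> = pconv p ((pdiff p ^^ t) (\<lambda>m. real (piltz t m))) m"
    by (simp add: pdiff_piltz_Suc pdiff_funpow_pconv assms)
  also have "\<dots> = (\<Sum>d | d dvd m \<and> \<not> p dvd d. if p dvd m div d then 0 else real (piltz t (m div d)))"
    by (simp add: pconv_def Suc.IH)
  also have "\<dots> = (if p dvd m then 0 else real (piltz (Suc t) m))"
  proof (cases "p dvd m")
    case True
    have "p dvd m div d" if "d dvd m" "\<not> p dvd d" for d
      using that True assms by (metis prime_dvd_mult_iff dvd_mult_div_cancel)
    then have "(\<Sum>d | d dvd m \<and> \<not> p dvd d. if p dvd m div d then 0 else real (piltz t (m div d))) = 0"
      by (intro sum.neutral) simp
    then show ?thesis using True by simp
  next
    case False
    then have m: "m > 0" by (intro Nat.gr0I) auto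
    have eq: "{d. d dvd m \<and> \<not> p dvd d} = {d. d dvd m}"
      using False by (auto dest: dvd_trans)
    have "\<not> p dvd m div d" if "d dvd m" for d
      using False that by (metis dvd_mult dvd_mult_div_cancel)
    then show ?thesis using False unfolding eq piltz_Suc[OF m] by simp
  qed
  finally show ?case .
qed

section \<open>The coprimality sieve\<close>

text \<open>\<open>V\<close> is the set of local exponent vectors. The value is the sum of $w(d)\prod_p h(v_p)$ over
  the tuples $d$ with $d_i = \prod_{p<n} p^{v_p(i)}$, where each $v_p$ ranges over \<open>V\<close>.\<close>

primrec euler_sum ::
    "(nat \<Rightarrow> nat) set \<Rightarrow> ((nat \<Rightarrow> nat) \<Rightarrow> real) \<Rightarrow> nat \<Rightarrow> ((nat \<Rightarrow> nat) \<Rightarrow> real) \<Rightarrow> real" where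
  "euler_sum V h 0 w = w (\<lambda>_. 1)"
| "euler_sum V h (Suc n) w =
     (if prime n then \<Sum>v\<in>V. h v * euler_sum V h n (\<lambda>d. w (\<lambda>i. d i * n ^ v i))
      else euler_sum V h n w)"

text \<open>Positivity is the invariant of the accumulated tuple d: it starts at the constant 1 and
  is only multiplied by prime powers. In the application the exponents off the index set are
  \<open>undefined\<close>, so nothing finer is known there.\<close>

lemma euler_sum_cong:
  assumes "\<And>d. (\<And>i. d i > 0) \<Longrightarrow> w d = w' d"
  shows "euler_sum V h n w = euler_sum V h n w'"
  using assms
proof (induction n arbitrary: w w')
  case (Suc n)
  show ?case
  proof (cases "prime n")
    case True
    have "euler_sum V h n (\<lambda>d. w (\<lambda>i. d i * n ^ v i)) = euler_sum V h n (\<lambda>d. w' (\<lambda>i. d i * n ^ v i))" for v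
      by (rule Suc.IH, rule Suc.prems) (use prime_gt_0_nat[OF True] in auto)
    with True show ?thesis by simp
  next
    case False
    then show ?thesis using Suc.IH[of w w'] Suc.prems by simp
  qed
qed simp

text \<open>Passing to absolute values of the coefficients turns each error estimate into a
  pointwise bound on weights and an Euler product with nonnegative terms.\<close>

lemma abs_euler_sum_le:
  assumes "\<And>d. (\<And>i. d i > 0) \<Longrightarrow> \<bar>w d\<bar> \<le> w' d"
  shows "\<bar>euler_sum V h n w\<bar> \<le> euler_sum V (\<lambda>v. \<bar>h v\<bar>) n w'"
  using assms
proof (induction n arbitrary: w w')
  case (Suc n)
  show ?case
  proof (cases "prime n")
    case True
    have "\<bar>h v * euler_sum V h n (\<lambda>d. w (\<lambda>i. d i * n ^ v i))\<bar>
        \<le> \<bar>h v\<bar> * euler_sum V (\<lambda>v. \<bar>h v\<bar>) n (\<lambda>d. w' (\<lambda>i. d i * n ^ v i))" for v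
      unfolding abs_mult
      by (intro mult_left_mono Suc.IH Suc.prems) (use prime_gt_0_nat[OF True] in auto)
    then show ?thesis using True by (auto intro!: order_trans[OF sum_abs] sum_mono)
  next
    case False
    then show ?thesis using Suc.IH[of w w'] Suc.prems by simp
  qed
qed simp

lemma euler_sum_scale: "euler_sum V h n (\<lambda>d. c * w d) = c * euler_sum V h n w"
  by (induction n arbitrary: w) (simp_all add: sum_distrib_left mult_ac)

lemma euler_sum_diff: "euler_sum V h n (\<lambda>d. w d - w' d) = euler_sum V h n w - euler_sum V h n w'"
  by (induction n arbitrary: w w') (simp_all add: sum_subtractf right_diff_distrib)

lemma euler_sum_add: "euler_sum V h n (\<lambda>d. w d + w' d) = euler_sum V h n w + euler_sum V h n w'"
  by (induction n arbitrary: w w') (simp_all add: sum.distrib algebra_simps)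

lemma euler_sum_zero: "euler_sum V h n (\<lambda>d. 0) = 0"
  by (induction n) simp_all

lemma euler_sum_sum: "euler_sum V h n (\<lambda>d. \<Sum>k\<in>K. w k d) = (\<Sum>k\<in>K. euler_sum V h n (w k))"
  by (induction K rule: infinite_finite_induct) (simp_all add: euler_sum_add euler_sum_zero)

text \<open>Complete multiplicativity lets the weight of the prime powers of n leave the inner sum
  as a scalar, so every prime splits off one factor.\<close>

lemma euler_sum_multiplicative:
  assumes "\<And>d e. (\<And>i. d i > 0) \<Longrightarrow> (\<And>i. e i > 0) \<Longrightarrow> w (\<lambda>i. d i * e i) = w d * w e"
    and "w (\<lambda>_. 1) = 1"
  shows "euler_sum V h n w = (\<Prod>p<n. if prime p then \<Sum>v\<in>V. h v * w (\<lambda>i. p ^ v i) else 1)"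
proof (induction n)
  case (Suc n)
  show ?case
  proof (cases "prime n")
    case True
    have "euler_sum V h n (\<lambda>d. w (\<lambda>i. d i * n ^ v i)) = euler_sum V h n (\<lambda>d. w (\<lambda>i. n ^ v i) * w d)" for v
      by (rule euler_sum_cong, subst assms(1)) (use prime_gt_0_nat[OF True] in auto)
    then have "euler_sum V h n (\<lambda>d. w (\<lambda>i. d i * n ^ v i)) = w (\<lambda>i. n ^ v i) * euler_sum V h n w" for v
      by (simp only: euler_sum_scale)
    then have "euler_sum V h (Suc n) w = (\<Sum>v\<in>V. h v * w (\<lambda>i. n ^ v i)) * euler_sum V h n w"
      using True by (simp add: sum_distrib_right mult.assoc)
    then show ?thesis using True unfolding Suc.IH by (simp add: mult.commute)
  qed (simp add: Suc.IH)
qed (use assms(2) in simp)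

section \<open>Local coefficients and the sieve by one prime\<close>

locale coprime_sieve =
  fixes I :: "nat set" and t :: "nat \<Rightarrow> nat" and T :: nat
  assumes finite_I [simp]: "finite I" and t_le: "i \<in> I \<Longrightarrow> t i \<le> T"
begin

text \<open>One common range up to \<open>T\<close> serves all coordinates, like the single t in the
  stated product; the binomial coefficients in \<open>h\<close> vanish beyond
  \<open>t i\<close>.\<close>

definition exps :: "(nat \<Rightarrow> nat) set" where
  "exps = I \<rightarrow>\<^sub>E {..T}"

text \<open>The local Dirichlet coefficients of
  $\prod_i (1-X_i)^{t_i}\bigl(1+\sum_i ((1-X_i)^{-t_i}-1)\bigr)$, the quotient of the Euler factor
  of the coprime sum by that of the unrestricted one.\<close>

definition h :: "(nat \<Rightarrow> nat) \<Rightarrow> real" where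
  "h v = (1 - real (card {i\<in>I. v i > 0})) * (\<Prod>i\<in>I. (- 1) ^ v i * real (t i choose v i))"

lemma finite_exps [simp]: "finite exps"
  by (auto simp: exps_def intro: finite_PiE)

text \<open>The cardinality in \<open>h\<close> counts the l with \<open>v l > 0\<close>. Singling
  out one such l strikes the term a = 0 from the l-th factor, leaving \<open>u l - g l 0\<close>.
  The function \<open>g\<close> is arbitrary because it is used both for shifted Piltz values and
  for powers of 1/p.\<close>

lemma sum_local:
  fixes g :: "nat \<Rightarrow> nat \<Rightarrow> real"
  defines "u \<equiv> \<lambda>i. \<Sum>a\<le>T. (- 1) ^ a * real (t i choose a) * g i a"
  shows "(\<Sum>v\<in>exps. h v * (\<Prod>i\<in>I. g i (v i)))
    = (\<Prod>i\<in>I. u i) - (\<Sum>l\<in>I. (u l - g l 0) * (\<Prod>i\<in>I - {l}. u i))"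
proof -
  define e where "e = (\<lambda>i a. (- 1) ^ a * real (t i choose a) * g i a)"
  have all: "(\<Sum>v\<in>exps. \<Prod>i\<in>I. e i (v i)) = (\<Prod>i\<in>I. u i)"
    unfolding exps_def u_def e_def by (rule prod_sum_PiE[symmetric]) auto
  have one: "(\<Sum>v\<in>exps. of_bool (0 < v l) * (\<Prod>i\<in>I. e i (v i))) = (u l - g l 0) * (\<Prod>i\<in>I - {l}. u i)"
    if l: "l \<in> I" for l
  proof -
    have "(\<Sum>v\<in>exps. of_bool (v l > 0) * (\<Prod>i\<in>I. e i (v i)))
        = (\<Sum>v\<in>exps. \<Prod>i\<in>I. e i (v i) * (if i = l then of_bool (v i > 0) else 1))"
      using l by (intro sum.cong refl) (simp add: prod.remove[of I l] mult_ac)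
    also have "\<dots> = (\<Prod>i\<in>I. \<Sum>a\<le>T. e i a * (if i = l then of_bool (a > 0) else 1))"
      unfolding exps_def by (rule prod_sum_PiE[symmetric]) auto
    also have "\<dots> = (\<Sum>a\<le>T. e l a * of_bool (a > 0)) * (\<Prod>i\<in>I - {l}. u i)"
      using l by (subst prod.remove[of I l]) (auto simp: u_def e_def intro!: prod.cong)
    also have "(\<Sum>a\<le>T. e l a * of_bool (a > 0)) = u l - g l 0"
    proof -
      have "u l = e l 0 + (\<Sum>a\<in>{..T} - {0}. e l a)"
        unfolding u_def e_def by (subst sum.remove[of _ 0]) auto
      moreover have "(\<Sum>a\<le>T. e l a * of_bool (a > 0)) = (\<Sum>a\<in>{..T} - {0}. e l a)"
        by (subst sum.remove[of _ 0]) (auto intro!: sum.cong)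
      ultimately show ?thesis by (simp add: e_def)
    qed
    finally show ?thesis .
  qed
  have "(\<Sum>v\<in>exps. h v * (\<Prod>i\<in>I. g i (v i)))
      = (\<Sum>v\<in>exps. (\<Prod>i\<in>I. e i (v i)) - (\<Sum>l\<in>I. of_bool (v l > 0) * (\<Prod>i\<in>I. e i (v i))))"
  proof (intro sum.cong refl)
    fix v :: "nat \<Rightarrow> nat"
    have "real (card {i\<in>I. v i > 0}) = (\<Sum>l\<in>I. of_bool (v l > 0))"
      by (simp add: Int_def)
    then show "h v * (\<Prod>i\<in>I. g i (v i)) = (\<Prod>i\<in>I. e i (v i)) - (\<Sum>l\<in>I. of_bool (v l > 0) * (\<Prod>i\<in>I. e i (v i)))"
      unfolding h_def e_def sum_distrib_right[symmetric] prod.distrib by (simp add: algebra_simps)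
  qed
  also have "\<dots> = (\<Prod>i\<in>I. u i) - (\<Sum>l\<in>I. \<Sum>v\<in>exps. of_bool (v l > 0) * (\<Prod>i\<in>I. e i (v i)))"
    unfolding sum_subtractf all by (subst sum.swap) simp
  also have "\<dots> = (\<Prod>i\<in>I. u i) - (\<Sum>l\<in>I. (u l - g l 0) * (\<Prod>i\<in>I - {l}. u i))"
    by (simp only: one cong: sum.cong)
  finally show ?thesis .
qed

lemma h_zero: "(\<And>i. i \<in> I \<Longrightarrow> v i = 0) \<Longrightarrow> h v = 1"
proof -
  assume *: "\<And>i. i \<in> I \<Longrightarrow> v i = 0"
  then have "{i\<in>I. v i > 0} = {}" by auto
  with * show "h v = 1" by (simp add: h_def)
qed

text \<open>The factor 1 - card vanishes when exactly one entry is positive. This is the source of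
  all convergence: no prime occurs in just one coordinate.\<close>

lemma h_nonzero_cases:
  assumes "h v \<noteq> 0"
  obtains "\<And>i. i \<in> I \<Longrightarrow> v i = 0" | i j where "i \<in> I" "j \<in> I" "i \<noteq> j" "v i > 0" "v j > 0"
proof -
  let ?L = "{i\<in>I. v i > 0}"
  have "card ?L \<noteq> 1" using assms by (auto simp: h_def)
  then consider "card ?L = 0" | "card ?L \<ge> 2" by linarith
  then show ?thesis
  proof cases
    case 1
    then have "?L = {}" by simp
    then have "\<forall>i\<in>I. v i = 0" by (simp add: Collect_empty_eq)
    then have "v i = 0" if "i \<in> I" for i using that by simp
    then show ?thesis by (rule that(1))
  next
    case 2
    then obtain i where i: "i \<in> ?L" by (metis card.empty all_not_in_conv not_numeral_le_zero)
    have "?L \<noteq> {i}" using 2 by auto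
    with i obtain j where "j \<in> ?L" "j \<noteq> i" by blast
    then show ?thesis using that(2)[of i j] i by auto
  qed
qed

text \<open>Testing only primes below n lets the condition be built up by induction, one prime at a
  time.\<close>

definition coprime_below :: "nat \<Rightarrow> (nat \<Rightarrow> nat) \<Rightarrow> bool" where
  "coprime_below n m \<longleftrightarrow> pairwise (\<lambda>i j. \<forall>p<n. prime p \<longrightarrow> \<not> (p dvd m i \<and> p dvd m j)) I"

text \<open>Here \<open>u i\<close> is 0 if p divides \<open>m i\<close> and the Piltz value
  otherwise. If p divides no entry, the first product is the answer. If it divides exactly one entry
  l, only the l-th term of the second sum survives, and its minus sign restores the full product. If
  it divides two or more, a vanishing \<open>u i\<close> remains in every term.\<close>

lemma sum_local_piltz:
  assumes p: "prime p"
  shows "(\<Sum>v\<in>exps. h v * (\<Prod>i\<in>I. if p ^ v i dvd m i then real (piltz (t i) (m i div p ^ v i)) else 0))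
    = (\<Prod>i\<in>I. real (piltz (t i) (m i))) * of_bool (pairwise (\<lambda>i j. \<not> (p dvd m i \<and> p dvd m j)) I)"
proof -
  define g where "g = (\<lambda>i a. if p ^ a dvd m i then real (piltz (t i) (m i div p ^ a)) else 0)"
  define u where "u = (\<lambda>i. \<Sum>a\<le>T. (- 1) ^ a * real (t i choose a) * g i a)"
  define B where "B = {i\<in>I. p dvd m i}"
  have u: "u i = (if p dvd m i then 0 else g i 0)" if "i \<in> I" for i
  proof -
    have "u i = (\<Sum>a\<le>t i. (- 1) ^ a * real (t i choose a) * g i a)"
      unfolding u_def by (rule sum.mono_neutral_right) (use t_le[OF that] in auto)
    also have "\<dots> = (pdiff p ^^ t i) (\<lambda>m. real (piltz (t i) m)) (m i)"
      using prime_gt_0_nat[OF p] by (simp add: pdiff_funpow g_def)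
    also have "\<dots> = (if p dvd m i then 0 else g i 0)"
      by (simp add: pdiff_funpow_piltz[OF p] g_def)
    finally show ?thesis .
  qed
  have "(\<Sum>v\<in>exps. h v * (\<Prod>i\<in>I. g i (v i)))
      = (\<Prod>i\<in>I. u i) - (\<Sum>l\<in>I. (u l - g l 0) * (\<Prod>i\<in>I - {l}. u i))"
    unfolding u_def by (rule sum_local)
  also have "\<dots> = (\<Prod>i\<in>I. g i 0) * of_bool (pairwise (\<lambda>i j. \<not> (p dvd m i \<and> p dvd m j)) I)"
  proof (cases "B = {}")
    case True
    then have nd: "\<not> p dvd m i" if "i \<in> I" for i using that by (auto simp: B_def)
    then have "(\<Prod>i\<in>I. u i) = (\<Prod>i\<in>I. g i 0)" by (intro prod.cong refl) (simp add: u)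
    moreover have "(\<Sum>l\<in>I. (u l - g l 0) * (\<Prod>i\<in>I - {l}. u i)) = 0"
      by (intro sum.neutral) (simp add: u nd)
    moreover have "pairwise (\<lambda>i j. \<not> (p dvd m i \<and> p dvd m j)) I"
      using nd by (auto simp: pairwise_def)
    ultimately show ?thesis by simp
  next
    case False
    then obtain l where l: "l \<in> I" "p dvd m l" by (auto simp: B_def)
    have u0: "(\<Prod>i\<in>I. u i) = 0" using l by (intro prod_zero) (auto simp: u)
    show ?thesis
    proof (cases "B = {l}")
      case True
      then have nd: "\<not> p dvd m i" if "i \<in> I" "i \<noteq> l" for i using that by (auto simp: B_def)
      have "(\<Sum>k\<in>I. (u k - g k 0) * (\<Prod>i\<in>I - {k}. u i)) = (u l - g l 0) * (\<Prod>i\<in>I - {l}. u i)"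
        by (subst sum.remove[of I l]) (use l nd in \<open>auto intro!: sum.neutral simp: u\<close>)
      also have "(\<Prod>i\<in>I - {l}. u i) = (\<Prod>i\<in>I - {l}. g i 0)"
        by (intro prod.cong refl) (simp add: u nd)
      also have "(u l - g l 0) * \<dots> = - (\<Prod>i\<in>I. g i 0)"
        using l by (simp add: u prod.remove[of I l])
      moreover have "pairwise (\<lambda>i j. \<not> (p dvd m i \<and> p dvd m j)) I"
        using nd by (auto simp: pairwise_def)
      ultimately show ?thesis by (simp add: u0)
    next
      case False
      then obtain k where k: "k \<in> I" "p dvd m k" "k \<noteq> l" using l by (auto simp: B_def)
      have "(\<Sum>j\<in>I. (u j - g j 0) * (\<Prod>i\<in>I - {j}. u i)) = 0"
      proof (intro sum.neutral ballI)
        fix j assume j: "j \<in> I"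
        obtain i where "i \<in> I - {j}" "p dvd m i" using k l by (cases "j = l") auto
        then have "(\<Prod>i\<in>I - {j}. u i) = 0" by (intro prod_zero) (auto simp: u)
        then show "(u j - g j 0) * (\<Prod>i\<in>I - {j}. u i) = 0" by simp
      qed
      moreover have "\<not> pairwise (\<lambda>i j. \<not> (p dvd m i \<and> p dvd m j)) I"
        using k l by (auto simp: pairwise_def)
      ultimately show ?thesis by (simp add: u0)
    qed
  qed
  finally show ?thesis by (simp add: g_def)
qed

text \<open>The bounds depend on i and vary in the induction: entries divisible by n^(v i) are
  divided by this power, which shrinks \<open>N i\<close> to \<open>N i div n ^ v i\<close>.\<close>

lemma sum_coprime_below:
  "(\<Sum>m\<in>(\<Pi>\<^sub>E i\<in>I. {1..N i}). (\<Prod>i\<in>I. real (piltz (t i) (m i))) * of_bool (coprime_below n m))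
    = euler_sum exps h n (\<lambda>d. \<Prod>i\<in>I. \<Sum>k=1..N i div d i. real (piltz (t i) k))"
proof (induction n arbitrary: N)
  case 0
  have "coprime_below 0 m" for m by (simp add: coprime_below_def pairwise_def)
  then show ?case by (simp add: prod_sum_PiE)
next
  case (Suc n)
  have cop_Suc: "coprime_below (Suc n) m \<longleftrightarrow> coprime_below n m \<and>
      (prime n \<longrightarrow> pairwise (\<lambda>i j. \<not> (n dvd m i \<and> n dvd m j)) I)" for m
    unfolding coprime_below_def pairwise_def less_Suc_eq by blast
  show ?case
  proof (cases "prime n")
    case False
    then show ?thesis using Suc.IH by (simp add: cop_Suc)
  next
    case True
    define f where "f = (\<lambda>m. \<Prod>i\<in>I. real (piltz (t i) (m i)))"
    have div_swap: "N i div (a * b) = N i div b div a" for i a b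
      by (metis div_mult2_eq mult.commute)
    have n0: "n ^ k > 0" for k using prime_gt_0_nat[OF True] by simp
    \<comment> \<open>The right side is supported on the tuples of the full box whose i-th entry is
      a multiple of n^(v i); dividing these powers out is a bijection onto the smaller box.\<close>
    have shift: "(\<Sum>m\<in>(\<Pi>\<^sub>E i\<in>I. {1..N i div n ^ v i}). f m * of_bool (coprime_below n m))
        = (\<Sum>m\<in>(\<Pi>\<^sub>E i\<in>I. {1..N i}). (\<Prod>i\<in>I. if n ^ v i dvd m i then real (piltz (t i) (m i div n ^ v i)) else 0)
             * of_bool (coprime_below n m))" for v
    proof -
      let ?B = "\<Pi>\<^sub>E i\<in>I. {1..N i}"
      let ?F = "\<lambda>m. (\<Prod>i\<in>I. if n ^ v i dvd m i then real (piltz (t i) (m i div n ^ v i)) else 0)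
             * of_bool (coprime_below n m)"
      have "(\<Sum>m\<in>?B. ?F m) = (\<Sum>m\<in>{m\<in>?B. \<forall>i\<in>I. n ^ v i dvd m i}. ?F m)"
      proof (rule sum.mono_neutral_right)
        show "finite ?B" by (intro finite_PiE) auto
        show "\<forall>m\<in>?B - {m\<in>?B. \<forall>i\<in>I. n ^ v i dvd m i}. ?F m = 0"
        proof
          fix m assume "m \<in> ?B - {m\<in>?B. \<forall>i\<in>I. n ^ v i dvd m i}"
          then obtain i where "i \<in> I" "\<not> n ^ v i dvd m i" by auto
          then have "(\<Prod>i\<in>I. if n ^ v i dvd m i then real (piltz (t i) (m i div n ^ v i)) else 0) = 0"
            by (intro prod_zero) auto
          then show "?F m = 0" by simp
        qed
      qed auto
      also have "\<dots> = (\<Sum>m\<in>(\<Pi>\<^sub>E i\<in>I. {1..N i div n ^ v i}). f m * of_bool (coprime_below n m))"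
      proof (rule sum.reindex_bij_witness[of _ "\<lambda>m. \<lambda>i\<in>I. m i * n ^ v i" "\<lambda>m. \<lambda>i\<in>I. m i div n ^ v i"])
        fix m assume m: "m \<in> {m\<in>?B. \<forall>i\<in>I. n ^ v i dvd m i}"
        show "(\<lambda>i\<in>I. (\<lambda>i\<in>I. m i div n ^ v i) i * n ^ v i) = m"
          using m by (intro ext) (auto simp: PiE_def extensional_def restrict_def)
        have pos: "m i div n ^ v i \<ge> 1" if "i \<in> I" for i
        proof -
          have "m i > 0" "n ^ v i dvd m i" using m that by (auto simp: PiE_def Pi_def)
          then show ?thesis using n0 by (simp add: Suc_le_eq div_greater_zero_iff dvd_imp_le)
        qed
        have le: "m i div n ^ v i \<le> N i div n ^ v i" if "i \<in> I" for i
          using m that by (intro div_le_mono) (auto simp: PiE_def Pi_def)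
        show "(\<lambda>i\<in>I. m i div n ^ v i) \<in> (\<Pi>\<^sub>E i\<in>I. {1..N i div n ^ v i})"
          using pos le by (auto simp: PiE_def Pi_def)
        \<comment> \<open>n is itself prime, so removing powers of n does not affect divisibility by
          smaller primes.\<close>
        have cop: "coprime_below n (\<lambda>i\<in>I. m i div n ^ v i) = coprime_below n m"
        proof -
          have "q dvd m i div n ^ v i \<longleftrightarrow> q dvd m i" if "q < n" "prime q" "i \<in> I" for q i
          proof -
            have "\<not> q dvd n ^ v i"
              using that True by (metis prime_dvd_power primes_dvd_imp_eq less_irrefl)
            moreover have "m i = n ^ v i * (m i div n ^ v i)" using m that by simp
            ultimately show ?thesis using that(2) by (metis prime_dvd_mult_iff)
          qed
          then show ?thesis unfolding coprime_below_def pairwise_def by auto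
        qed
        show "f (\<lambda>i\<in>I. m i div n ^ v i) * of_bool (coprime_below n (\<lambda>i\<in>I. m i div n ^ v i)) = ?F m"
          unfolding cop using m by (auto simp: f_def intro!: prod.cong)
      next
        fix m assume m: "m \<in> (\<Pi>\<^sub>E i\<in>I. {1..N i div n ^ v i})"
        show "(\<lambda>i\<in>I. (\<lambda>i\<in>I. m i * n ^ v i) i div n ^ v i) = m"
          using m n0 by (intro ext) (auto simp: PiE_def extensional_def restrict_def)
        have "m i * n ^ v i \<le> N i" "m i * n ^ v i \<ge> 1" if "i \<in> I" for i
        proof -
          have "m i \<le> N i div n ^ v i" "m i \<ge> 1" using m that by (auto simp: PiE_def Pi_def)
          then show "m i * n ^ v i \<le> N i" "m i * n ^ v i \<ge> 1"
            using n0[of "v i"] by (simp_all add: less_eq_div_iff_mult_less_eq Suc_le_eq)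
        qed
        then show "(\<lambda>i\<in>I. m i * n ^ v i) \<in> {m\<in>?B. \<forall>i\<in>I. n ^ v i dvd m i}"
          by (auto simp: PiE_def Pi_def)
      qed
      finally show ?thesis by simp
    qed
    have "(\<Sum>m\<in>(\<Pi>\<^sub>E i\<in>I. {1..N i}). f m * of_bool (coprime_below (Suc n) m))
        = (\<Sum>m\<in>(\<Pi>\<^sub>E i\<in>I. {1..N i}). (\<Sum>v\<in>exps. h v * (\<Prod>i\<in>I. if n ^ v i dvd m i then real (piltz (t i) (m i div n ^ v i)) else 0))
             * of_bool (coprime_below n m))"
      unfolding sum_local_piltz[OF True] f_def using True
      by (simp only: cop_Suc of_bool_conj mult_ac simp_thms)
    also have "\<dots> = (\<Sum>v\<in>exps. h v * (\<Sum>m\<in>(\<Pi>\<^sub>E i\<in>I. {1..N i div n ^ v i}). f m * of_bool (coprime_below n m)))"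
      unfolding shift sum_distrib_left sum_distrib_right by (subst sum.swap) (simp add: mult_ac)
    also have "\<dots> = (\<Sum>v\<in>exps. h v * euler_sum exps h n (\<lambda>d. \<Prod>i\<in>I. \<Sum>k=1..N i div (d i * n ^ v i). real (piltz (t i) k)))"
      unfolding f_def Suc.IH div_swap ..
    finally show ?thesis using True by (simp add: f_def)
  qed
qed

end

section \<open>The Euler product\<close>

context coprime_sieve
begin

definition wpow :: "(nat \<Rightarrow> real) \<Rightarrow> (nat \<Rightarrow> nat) \<Rightarrow> real" where
  "wpow s d = (\<Prod>i\<in>I. real (d i) powr (- s i))"

lemma wpow_nonneg: "wpow s d \<ge> 0"
  by (simp add: wpow_def prod_nonneg)

lemma wpow_mult: "wpow s (\<lambda>i. d i * e i) = wpow s d * wpow s e"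
  by (simp add: wpow_def powr_mult prod.distrib)

lemma wpow_one: "wpow s (\<lambda>_. 1) = 1"
  by (simp add: wpow_def)

lemma wpow_prime_power:
  assumes "p > 0"
  shows "wpow s (\<lambda>i. p ^ v i) = real p powr (- (\<Sum>i\<in>I. s i * real (v i)))"
proof -
  have "wpow s (\<lambda>i. p ^ v i) = (\<Prod>i\<in>I. real p powr (- (s i * real (v i))))"
    unfolding wpow_def
    by (intro prod.cong refl) (use assms in \<open>simp add: powr_realpow[symmetric] powr_powr mult.commute\<close>)
  also have "\<dots> = real p powr (\<Sum>i\<in>I. - (s i * real (v i)))"
    using assms by (subst powr_sum) simp_all
  finally show ?thesis by (simp add: sum_negf)
qed

text \<open>The coefficients \<open>h\<close> do not depend on the prime, so this one constant
  serves all Euler factors.\<close>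

definition hnorm :: real where
  "hnorm = (\<Sum>v\<in>exps. \<bar>h v\<bar>)"

lemma hnorm_nonneg: "hnorm \<ge> 0"
  by (simp add: hnorm_def sum_nonneg)

text \<open>The zero vector as a member of \<open>exps\<close>: it is restricted to
  \<open>I\<close>, so off \<open>I\<close> it is \<open>undefined\<close> rather than 0.\<close>

definition zexp :: "nat \<Rightarrow> nat" where
  "zexp = (\<lambda>i\<in>I. 0)"

lemma zexp_mem: "zexp \<in> exps"
  by (simp add: zexp_def exps_def)

lemma h_zexp: "h zexp = 1"
  by (rule h_zero) (simp add: zexp_def)

text \<open>The region of absolute convergence with margin \<delta>. Only pairs are constrained,
  because \<open>h\<close> vanishes on vectors with a single positive entry.\<close>

definition admissible :: "real \<Rightarrow> (nat \<Rightarrow> real) \<Rightarrow> bool" where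
  "admissible \<delta> s \<longleftrightarrow> \<delta> > 0 \<and> (\<forall>i\<in>I. s i \<ge> 0) \<and> (\<forall>i\<in>I. \<forall>j\<in>I. i \<noteq> j \<longrightarrow> s i + s j \<ge> 1 + \<delta>)"

text \<open>A nonzero vector with nonzero coefficient has two positive entries i and j, so its power
  of 1/p is at least s_i + s_j >= 1 + \<delta>.\<close>

lemma sum_nontrivial_exps_le:
  assumes "admissible \<delta> s" "p > 0"
  shows "(\<Sum>v\<in>exps - {zexp}. \<bar>h v\<bar> * wpow s (\<lambda>i. p ^ v i)) \<le> hnorm * real p powr (- 1 - \<delta>)"
proof -
  have "\<bar>h v\<bar> * wpow s (\<lambda>i. p ^ v i) \<le> \<bar>h v\<bar> * real p powr (- 1 - \<delta>)" if v: "v \<in> exps - {zexp}" for v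
  proof (cases "h v = 0")
    case False
    then show ?thesis
    proof (cases rule: h_nonzero_cases)
      case 1
      then have "v = zexp" using v by (auto simp: zexp_def exps_def PiE_def extensional_def)
      with v show ?thesis by simp
    next
      case (2 i j)
      have "1 + \<delta> \<le> s i + s j" using assms 2 by (simp add: admissible_def)
      also have "\<dots> \<le> s i * real (v i) + s j * real (v j)"
        using assms 2 by (intro add_mono mult_right_le_imp_le[of "s _" 1] mult_le_cancel_left1[THEN iffD2]) (auto simp: admissible_def)
      also have "\<dots> = (\<Sum>k\<in>{i, j}. s k * real (v k))" using 2 by simp
      also have "\<dots> \<le> (\<Sum>k\<in>I. s k * real (v k))"
        using 2 assms by (intro sum_mono2) (auto simp: admissible_def)
      finally have "real p powr (- (\<Sum>k\<in>I. s k * real (v k))) \<le> real p powr (- 1 - \<delta>)"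
        using assms(2) by (intro powr_mono) auto
      then show ?thesis unfolding wpow_prime_power[OF assms(2)] by (intro mult_left_mono) auto
    qed
  qed simp
  then have "(\<Sum>v\<in>exps - {zexp}. \<bar>h v\<bar> * wpow s (\<lambda>i. p ^ v i))
      \<le> (\<Sum>v\<in>exps - {zexp}. \<bar>h v\<bar> * real p powr (- 1 - \<delta>))"
    by (rule sum_mono)
  also have "\<dots> \<le> (\<Sum>v\<in>exps. \<bar>h v\<bar> * real p powr (- 1 - \<delta>))"
    by (intro sum_mono2) auto
  finally show ?thesis by (simp add: hnorm_def sum_distrib_right)
qed

text \<open>Each Euler factor is at most 1 + \<open>f p\<close>, the 1 coming from
  \<open>zexp\<close>, and 1 + f <= exp f reduces the product to a convergent series. The bound does
  not depend on n, so the error estimates survive n tending to infinity.\<close>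

lemma euler_sum_wpow_bounded:
  assumes "admissible \<delta> s"
  obtains B where "B \<ge> 0" "\<And>n. euler_sum exps (\<lambda>v. \<bar>h v\<bar>) n (wpow s) \<le> B"
proof -
  define f where "f = (\<lambda>p::nat. hnorm * real p powr (- 1 - \<delta>))"
  have f0: "f p \<ge> 0" for p by (simp add: f_def hnorm_nonneg)
  have sf: "summable f"
    unfolding f_def using assms by (intro summable_mult) (simp add: summable_real_powr_iff admissible_def)
  have "euler_sum exps (\<lambda>v. \<bar>h v\<bar>) n (wpow s) \<le> exp (suminf f)" for n
  proof -
    have "euler_sum exps (\<lambda>v. \<bar>h v\<bar>) n (wpow s)
        = (\<Prod>p<n. if prime p then \<Sum>v\<in>exps. \<bar>h v\<bar> * wpow s (\<lambda>i. p ^ v i) else 1)"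
      by (rule euler_sum_multiplicative) (simp_all only: wpow_mult wpow_one)
    also have "\<dots> \<le> (\<Prod>p<n. 1 + f p)"
    proof (intro prod_mono conjI)
      fix p
      show "0 \<le> (if prime p then \<Sum>v\<in>exps. \<bar>h v\<bar> * wpow s (\<lambda>i. p ^ v i) else 1)"
        by (auto intro!: sum_nonneg simp: wpow_nonneg)
      show "(if prime p then \<Sum>v\<in>exps. \<bar>h v\<bar> * wpow s (\<lambda>i. p ^ v i) else 1) \<le> 1 + f p"
      proof (cases "prime p")
        case True
        then have p: "p > 0" by (simp add: prime_gt_0_nat)
        have "wpow s (\<lambda>i. p ^ zexp i) = 1" by (simp add: wpow_def zexp_def)
        then have "(\<Sum>v\<in>exps. \<bar>h v\<bar> * wpow s (\<lambda>i. p ^ v i))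
            = 1 + (\<Sum>v\<in>exps - {zexp}. \<bar>h v\<bar> * wpow s (\<lambda>i. p ^ v i))"
          by (subst sum.remove[of exps zexp]) (simp_all add: zexp_mem h_zexp)
        with sum_nontrivial_exps_le[OF assms p] True show ?thesis by (simp add: f_def)
      qed (simp add: f0)
    qed
    also have "\<dots> \<le> exp (\<Sum>p<n. f p)" by (rule prod_le_exp_sum) (simp add: f0)
    also have "\<dots> \<le> exp (suminf f)" using sum_le_suminf[OF sf] f0 by simp
    finally show ?thesis .
  qed
  then show ?thesis by (rule that[rotated]) simp
qed

text \<open>Telescoping over n: the step at a prime n collects the vectors other than
  \<open>zexp\<close> and is O(n^(-1-\<delta>)). The weight must ignore coordinates off
  \<open>I\<close>, since the exponents there are unspecified.\<close>

lemma convergent_euler_sum: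
  assumes adm: "admissible \<delta> s"
    and dep: "\<And>d d'. (\<And>i. i \<in> I \<Longrightarrow> d i = d' i) \<Longrightarrow> w d = w d'"
    and bound: "\<And>d. (\<And>i. d i > 0) \<Longrightarrow> \<bar>w d\<bar> \<le> C * wpow s d"
  shows "convergent (\<lambda>n. euler_sum exps h n w)"
proof -
  obtain B where B: "B \<ge> 0" "\<And>n. euler_sum exps (\<lambda>v. \<bar>h v\<bar>) n (wpow s) \<le> B"
    using euler_sum_wpow_bounded[OF adm] by blast
  have "\<bar>w (\<lambda>_. 1)\<bar> \<le> C" using bound[of "\<lambda>_. 1"] by (simp add: wpow_one[simplified])
  then have C: "C \<ge> 0" by linarith
  define D where "D n = euler_sum exps h (Suc n) w - euler_sum exps h n w" for n
  have "\<bar>D n\<bar> \<le> C * B * hnorm * real n powr (- 1 - \<delta>)" for n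
  proof (cases "prime n")
    case True
    then have n: "n > 0" by (simp add: prime_gt_0_nat)
    let ?E = "\<lambda>v. euler_sum exps h n (\<lambda>d. w (\<lambda>i. d i * n ^ v i))"
    \<comment> \<open>Multiplying by n to the power \<open>zexp\<close> changes d only off
      \<open>I\<close>, where the weight does not look.\<close>
    have "?E zexp = euler_sum exps h n w"
      by (intro euler_sum_cong dep) (simp add: zexp_def)
    then have "D n = (\<Sum>v\<in>exps - {zexp}. h v * ?E v)"
      using True by (simp add: D_def sum.remove[OF finite_exps zexp_mem] h_zexp)
    then have "\<bar>D n\<bar> = \<bar>\<Sum>v\<in>exps - {zexp}. h v * ?E v\<bar>" by (rule arg_cong)
    also have "\<dots> \<le> (\<Sum>v\<in>exps - {zexp}. \<bar>h v\<bar> * (C * wpow s (\<lambda>i. n ^ v i) * B))"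
    proof (intro order_trans[OF sum_abs] sum_mono)
      fix v
      have "\<bar>?E v\<bar> \<le> euler_sum exps (\<lambda>v. \<bar>h v\<bar>) n (\<lambda>d. C * wpow s (\<lambda>i. n ^ v i) * wpow s d)"
      proof (rule abs_euler_sum_le)
        fix d :: "nat \<Rightarrow> nat" assume "\<And>i. d i > 0"
        then have "\<bar>w (\<lambda>i. d i * n ^ v i)\<bar> \<le> C * wpow s (\<lambda>i. d i * n ^ v i)"
          using n by (intro bound) simp
        then show "\<bar>w (\<lambda>i. d i * n ^ v i)\<bar> \<le> C * wpow s (\<lambda>i. n ^ v i) * wpow s d"
          unfolding wpow_mult by (simp add: mult_ac)
      qed
      also have "\<dots> = C * wpow s (\<lambda>i. n ^ v i) * euler_sum exps (\<lambda>v. \<bar>h v\<bar>) n (wpow s)"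
        by (rule euler_sum_scale)
      also have "\<dots> \<le> C * wpow s (\<lambda>i. n ^ v i) * B"
        using B C by (intro mult_left_mono) (simp_all add: wpow_nonneg)
      finally show "\<bar>h v * ?E v\<bar> \<le> \<bar>h v\<bar> * (C * wpow s (\<lambda>i. n ^ v i) * B)"
        unfolding abs_mult by (intro mult_left_mono) auto
    qed
    also have "\<dots> = C * B * (\<Sum>v\<in>exps - {zexp}. \<bar>h v\<bar> * wpow s (\<lambda>i. n ^ v i))"
      by (simp add: sum_distrib_left mult_ac)
    also have "\<dots> \<le> C * B * (hnorm * real n powr (- 1 - \<delta>))"
      using B C by (intro mult_left_mono sum_nontrivial_exps_le adm n) auto
    finally show ?thesis by (simp add: mult_ac)
  qed (use B C hnorm_nonneg in \<open>simp add: D_def\<close>)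
  then have le: "norm (D n) \<le> C * B * hnorm * real n powr (- 1 - \<delta>)" for n by simp
  have "summable (\<lambda>n. C * B * hnorm * real n powr (- 1 - \<delta>))"
    using adm by (intro summable_mult) (simp add: summable_real_powr_iff admissible_def)
  then have "summable D" by (rule summable_comparison_test') (rule le)
  then have "convergent (\<lambda>n. \<Sum>k<n. D k)" by (simp add: summable_iff_convergent)
  then have "convergent (\<lambda>n. euler_sum exps h 0 w + (\<Sum>k<n. D k))"
    by (intro convergent_add convergent_const)
  moreover have "euler_sum exps h 0 w + (\<Sum>k<n. D k) = euler_sum exps h n w" for n
    unfolding D_def by (subst sum_lessThan_telescope) simp
  ultimately show ?thesis by simp
qed

section \<open>The Euler factors at s = (1, ..., 1) and the stated product\<close>

definition local_factor :: "nat \<Rightarrow> real" where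
  "local_factor p = (\<Sum>v\<in>exps. h v * wpow (\<lambda>_. 1) (\<lambda>i. p ^ v i))"

lemma euler_sum_wpow_one:
  "euler_sum exps h n (wpow (\<lambda>_. 1)) = (\<Prod>p<n. if prime p then local_factor p else 1)"
  unfolding local_factor_def by (rule euler_sum_multiplicative) (simp_all only: wpow_mult wpow_one)

text \<open>Puts the factor into the form that \<open>Delta_factor_eq_prods\<close> reaches from the
  stated sum over index sets, so that the two products agree factor by factor.\<close>

lemma local_factor_eq:
  assumes "p > 0"
  defines "u \<equiv> \<lambda>i. \<Sum>a\<le>T. (- 1) ^ a * real (t i choose a) * (1 / real p) ^ a"
  shows "local_factor p = (\<Prod>i\<in>I. u i) - (\<Sum>l\<in>I. (u l - 1) * (\<Prod>i\<in>I - {l}. u i))"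
proof -
  have "wpow (\<lambda>_. 1) (\<lambda>i. p ^ v i) = (\<Prod>i\<in>I. (1 / real p) ^ v i)" for v
    unfolding wpow_def using assms(1) by (simp add: powr_minus power_inverse divide_inverse)
  then show ?thesis
    unfolding local_factor_def u_def using sum_local[of "\<lambda>i a. (1 / real p) ^ a"] by simp
qed

text \<open>Since \<open>u i\<close> = (1 - 1/p)^(t i) lies in (0, 1], the subtracted sum has only
  nonpositive terms, and the product of the \<open>u i\<close> is positive.\<close>

lemma local_factor_pos:
  assumes "p \<ge> 2"
  shows "local_factor p > 0"
proof -
  define u where "u = (\<lambda>i. \<Sum>a\<le>T. (- 1) ^ a * real (t i choose a) * (1 / real p) ^ a)"
  have u: "u i = (1 - 1 / real p) ^ t i" if "i \<in> I" for i
  proof -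
    have "u i = (\<Sum>a\<le>t i. (- 1) ^ a * real (t i choose a) * (1 / real p) ^ a)"
      unfolding u_def by (rule sum.mono_neutral_right) (use t_le[OF that] in auto)
    also have "\<dots> = (- (1 / real p) + 1) ^ t i"
      unfolding binomial_ring by (intro sum.cong refl) (simp add: power_minus[of "1 / real p"] mult_ac)
    finally show ?thesis by simp
  qed
  have u01: "0 < u i \<and> u i \<le> 1" if "i \<in> I" for i
  proof -
    have "0 < 1 - 1 / real p" "1 - 1 / real p \<le> 1" using assms by simp_all
    then show ?thesis unfolding u[OF that] by (simp add: power_le_one)
  qed
  have "(\<Prod>i\<in>I. u i) > 0" using u01 by (intro prod_pos) auto
  moreover have "(\<Sum>l\<in>I. (u l - 1) * (\<Prod>i\<in>I - {l}. u i)) \<le> 0"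
    using u01 by (intro sum_nonpos mult_nonpos_nonneg prod_nonneg) (auto intro: less_imp_le)
  ultimately show ?thesis using local_factor_eq[of p] assms by (simp add: u_def)
qed

lemma convergent_prod_local_factor:
  "convergent_prod (\<lambda>p. if prime p then local_factor p else 1)"
proof -
  have adm: "admissible 1 (\<lambda>_. 1)" by (simp add: admissible_def)
  have le: "norm ((if prime p then local_factor p else 1) - 1) \<le> hnorm * real p powr (- 1 - 1)" for p
  proof (cases "prime p")
    case True
    then have p: "p > 0" by (simp add: prime_gt_0_nat)
    have "wpow (\<lambda>_. 1) (\<lambda>i. p ^ zexp i) = 1" by (simp add: wpow_def zexp_def)
    then have "local_factor p - 1 = (\<Sum>v\<in>exps - {zexp}. h v * wpow (\<lambda>_. 1) (\<lambda>i. p ^ v i))"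
      unfolding local_factor_def by (subst sum.remove[of exps zexp]) (simp_all add: zexp_mem h_zexp)
    then have "\<bar>local_factor p - 1\<bar> = \<bar>\<Sum>v\<in>exps - {zexp}. h v * wpow (\<lambda>_. 1) (\<lambda>i. p ^ v i)\<bar>" by (rule arg_cong)
    also have "\<dots> \<le> (\<Sum>v\<in>exps - {zexp}. \<bar>h v\<bar> * wpow (\<lambda>_. 1) (\<lambda>i. p ^ v i))"
      by (rule order_trans[OF sum_abs]) (simp add: abs_mult wpow_nonneg)
    also have "\<dots> \<le> hnorm * real p powr (- 1 - 1)" by (rule sum_nontrivial_exps_le[OF adm p])
    finally show ?thesis using True by simp
  qed (simp add: hnorm_nonneg)
  have "summable (\<lambda>p::nat. hnorm * real p powr (- 1 - 1))"
    by (intro summable_mult) (simp add: summable_real_powr_iff)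
  then have "summable (\<lambda>p. norm ((if prime p then local_factor p else 1) - 1))"
  proof (rule summable_comparison_test'[where N = 0])
    fix p :: nat
    show "norm (norm ((if prime p then local_factor p else 1) - 1)) \<le> hnorm * real p powr (- 1 - 1)"
      using le[of p] by simp
  qed
  then show ?thesis
    by (intro abs_convergent_prod_imp_convergent_prod) (simp add: abs_convergent_prod_conv_summable)
qed

text \<open>Keeps the top coefficient of the main polynomial from vanishing, so that its degree is
  exact.\<close>

lemma prodinf_local_factor_nonzero: "(\<Prod>p. if prime p then local_factor p else 1) \<noteq> 0"
proof (rule prodinf_nonzero[OF convergent_prod_local_factor])
  fix p
  show "(if prime p then local_factor p else 1) \<noteq> 0"
    using local_factor_pos[of p] prime_ge_2_nat[of p] by auto
qed

end

text \<open>Put y_l = u_l - 1. For fixed L the sum over exponents factors into the product of y_l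
  over L, so the stated factor becomes the sum of (1 - |L|) times this product over all subsets L.
  The part without |L| expands the product of 1 + y_i, and |L| counts the choices of a distinguished
  l in L.\<close>

lemma Delta_factor_eq_prods:
  fixes r p :: nat and t :: "nat \<Rightarrow> nat"
  assumes "p > 0"
  defines "T \<equiv> Max (t ` {1..r})"
  defines "u \<equiv> \<lambda>i. \<Sum>a\<le>T. (- 1) ^ a * real (t i choose a) * (1 / real p) ^ a"
  shows "Delta_factor r t p = (\<Prod>i\<in>{1..r}. u i) - (\<Sum>l\<in>{1..r}. (u l - 1) * (\<Prod>i\<in>{1..r} - {l}. u i))"
proof -
  let ?I = "{1..r}"
  define y where "y = (\<lambda>i. u i - 1)"
  have y: "y l = (\<Sum>a\<in>{1..T}. 1 / real p ^ a * ((- 1) ^ a * real (t l choose a)))" for l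
    unfolding y_def u_def
    by (subst sum.remove[of _ 0]) (auto intro!: sum.cong simp: power_one_over mult_ac)
  have "(\<Sum>a\<in>L \<rightarrow>\<^sub>E {1..T}. 1 / real p ^ (\<Sum>l\<in>L. a l) * (\<Prod>l\<in>L. (- 1) ^ a l * real (t l choose a l)))
      = (\<Prod>l\<in>L. y l)" if "L \<subseteq> ?I" for L
  proof -
    have "finite L" using that by (rule finite_subset) simp
    then have "(\<Prod>l\<in>L. y l) = (\<Sum>a\<in>L \<rightarrow>\<^sub>E {1..T}. \<Prod>l\<in>L. 1 / real p ^ a l * ((- 1) ^ a l * real (t l choose a l)))"
      unfolding y by (rule prod_sum_PiE) simp
    also have "\<dots> = (\<Sum>a\<in>L \<rightarrow>\<^sub>E {1..T}. 1 / real p ^ (\<Sum>l\<in>L. a l) * (\<Prod>l\<in>L. (- 1) ^ a l * real (t l choose a l)))"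
      by (intro sum.cong refl) (simp only: prod.distrib power_sum prod_dividef prod.neutral_const)
    finally show ?thesis by simp
  qed
  then have "Delta_factor r t p = 1 - (\<Sum>i=2..r. (real i - 1) * (\<Sum>L\<in>{L. L \<subseteq> ?I \<and> card L = i}. \<Prod>l\<in>L. y l))"
    unfolding Delta_factor_def T_def[symmetric] by simp
  also have "(\<Sum>i=2..r. (real i - 1) * (\<Sum>L\<in>{L. L \<subseteq> ?I \<and> card L = i}. \<Prod>l\<in>L. y l))
      = (\<Sum>i\<le>r. (real i - 1) * (\<Sum>L\<in>{L. L \<subseteq> ?I \<and> card L = i}. \<Prod>l\<in>L. y l)) + 1"
  proof -
    \<comment> \<open>The term i = 0 is -1 and the term i = 1 is 0, so the sum extends to all subset
      sizes at the cost of adding 1.\<close>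
    define f where "f = (\<lambda>i. (real i - 1) * (\<Sum>L\<in>{L. L \<subseteq> ?I \<and> card L = i}. \<Prod>l\<in>L. y l))"
    have "{L. L \<subseteq> ?I \<and> card L = 0} = {{}}" by (auto simp: card_eq_0_iff intro: finite_subset)
    then have f0: "f 0 = - 1" by (simp add: f_def)
    have f1: "f 1 = 0" by (simp add: f_def)
    have "(\<Sum>i\<le>r. f i) = f 0 + (\<Sum>i\<in>{..r} - {0}. f i)" by (subst sum.remove[of _ 0]) auto
    also have "(\<Sum>i\<in>{..r} - {0}. f i) = (\<Sum>i\<in>{2..r}. f i)"
      by (rule sum.mono_neutral_right) (use f1 in \<open>auto simp: numeral_2_eq_2 not_less_eq_eq le_Suc_eq\<close>)
    finally show ?thesis using f0 by (simp add: f_def)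
  qed
  also have "(\<Sum>i\<le>r. (real i - 1) * (\<Sum>L\<in>{L. L \<subseteq> ?I \<and> card L = i}. \<Prod>l\<in>L. y l))
      = (\<Sum>L\<in>Pow ?I. (real (card L) - 1) * (\<Prod>l\<in>L. y l))"
  proof -
    have "card L \<le> r" if "L \<subseteq> ?I" for L using card_mono[OF _ that] by simp
    then have "(\<Sum>L\<in>Pow ?I. (real (card L) - 1) * (\<Prod>l\<in>L. y l))
        = (\<Sum>i\<le>r. \<Sum>L\<in>{L \<in> Pow ?I. card L = i}. (real (card L) - 1) * (\<Prod>l\<in>L. y l))"
      by (intro sum.group[symmetric]) auto
    then show ?thesis by (simp add: sum_distrib_left)
  qed
  also have "\<dots> = (\<Sum>l\<in>?I. y l * (\<Prod>i\<in>?I - {l}. u i)) - (\<Prod>i\<in>?I. u i)"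
  proof -
    have one: "(\<Sum>L\<in>Pow ?I. of_bool (l \<in> L) * (\<Prod>l\<in>L. y l)) = y l * (\<Prod>i\<in>?I - {l}. u i)" if l: "l \<in> ?I" for l
    proof -
      \<comment> \<open>Replacing the summand 1 by 0 at position l kills every subset not containing
        l in the expansion.\<close>
      have "y l * (\<Prod>i\<in>?I - {l}. u i) = (\<Prod>i\<in>?I. y i + of_bool (i \<noteq> l))"
        using l by (subst prod.remove[of ?I l]) (auto intro!: prod.cong simp: y_def)
      also have "\<dots> = (\<Sum>L\<in>Pow ?I. (\<Prod>i\<in>L. y i) * (\<Prod>i\<in>?I - L. of_bool (i \<noteq> l)))"
        by (rule prod_add) simp
      also have "\<dots> = (\<Sum>L\<in>Pow ?I. of_bool (l \<in> L) * (\<Prod>l\<in>L. y l))"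
      proof (intro sum.cong refl)
        fix L
        have "(\<Prod>i\<in>?I - L. of_bool (i \<noteq> l)) = (of_bool (l \<in> L) :: real)"
          using l by (cases "l \<in> L") (auto intro!: prod.neutral prod_zero)
        then show "(\<Prod>i\<in>L. y i) * (\<Prod>i\<in>?I - L. of_bool (i \<noteq> l)) = of_bool (l \<in> L) * (\<Prod>l\<in>L. y l)"
          by simp
      qed
      finally show ?thesis by simp
    qed
    have card: "real (card L) = (\<Sum>l\<in>?I. of_bool (l \<in> L))" if "L \<in> Pow ?I" for L
      using that by (simp add: Int_absorb1)
    have "(\<Sum>L\<in>Pow ?I. real (card L) * (\<Prod>l\<in>L. y l)) = (\<Sum>l\<in>?I. y l * (\<Prod>i\<in>?I - {l}. u i))"
      by (simp only: card sum_distrib_right one sum.swap[of _ _ "Pow ?I"] cong: sum.cong)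
    moreover have "(\<Sum>L\<in>Pow ?I. \<Prod>l\<in>L. y l) = (\<Prod>i\<in>?I. u i)"
      using prod_add[of ?I y "\<lambda>_. 1"] by (simp add: y_def)
    ultimately show ?thesis by (simp add: left_diff_distrib sum_subtractf)
  qed
  finally show ?thesis by (simp add: y_def)
qed

section \<open>Analytic estimates\<close>

definition piltz_sum :: "nat \<Rightarrow> nat \<Rightarrow> real" where
  "piltz_sum t N = (\<Sum>n=1..N. real (piltz t n))"

lemma piltz_sum_nonneg: "piltz_sum t N \<ge> 0"
  by (simp add: piltz_sum_def sum_nonneg)

text \<open>Writing n = d k, both sides count the pairs (d, k) with d k <= N, weighted by the Piltz
  value at k.\<close>

lemma piltz_sum_Suc: "piltz_sum (Suc t) N = (\<Sum>d=1..N. piltz_sum t (N div d))"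
proof -
  have "piltz_sum (Suc t) N = (\<Sum>n=1..N. \<Sum>d | d dvd n. real (piltz t (n div d)))"
    unfolding piltz_sum_def by (intro sum.cong refl) (simp add: piltz_Suc)
  also have "\<dots> = (\<Sum>(n, d)\<in>(SIGMA n:{1..N}. {d. d dvd n}). real (piltz t (n div d)))"
    by (rule sum.Sigma) auto
  also have "\<dots> = (\<Sum>(d, k)\<in>(SIGMA d:{1..N}. {1..N div d}). real (piltz t k))"
  proof (rule sum.reindex_bij_witness[of _ "\<lambda>(d, k). (d * k, d)" "\<lambda>(n, d). (d, n div d)"])
    fix a assume "a \<in> (SIGMA n:{1..N}. {d. d dvd n})"
    then obtain n d where a: "a = (n, d)" "n \<ge> 1" "n \<le> N" "d dvd n" by auto
    then have "d \<ge> 1" "d \<le> N" "n div d \<ge> 1"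
      using dvd_imp_le[of d n] by (auto simp: Suc_le_eq div_greater_zero_iff intro!: Nat.gr0I)
    then show "(\<lambda>(n, d). (d, n div d)) a \<in> (SIGMA d:{1..N}. {1..N div d})"
      using a by (auto intro: div_le_mono)
  next
    fix b assume "b \<in> (SIGMA d:{1..N}. {1..N div d})"
    then obtain d k where b: "b = (d, k)" "d \<ge> 1" "k \<ge> 1" "k \<le> N div d" by auto
    then have "d * k \<le> N" by (metis less_eq_div_iff_mult_less_eq less_le_trans zero_less_one mult.commute)
    then show "(\<lambda>(d, k). (d * k, d)) b \<in> (SIGMA n:{1..N}. {d. d dvd n})"
      using b by auto
  qed auto
  also have "\<dots> = (\<Sum>d=1..N. piltz_sum t (N div d))"
    unfolding piltz_sum_def by (rule sum.Sigma[symmetric]) auto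
  finally show ?thesis .
qed

text \<open>Each increase of the order costs a factor zeta(1 + \<epsilon>), which is
  \<open>Z\<close>. Unlike the asymptotic hypothesis, this bound holds for every N.\<close>

lemma piltz_sum_bound:
  assumes "\<epsilon> > 0"
  obtains C where "C \<ge> 0" "\<And>N. piltz_sum t N \<le> C * real N powr (1 + \<epsilon>)"
proof -
  define Z where "Z = (\<Sum>d::nat. real d powr (- 1 - \<epsilon>))"
  have sZ: "summable (\<lambda>d::nat. real d powr (- 1 - \<epsilon>))" using assms by (simp add: summable_real_powr_iff)
  have Z: "(\<Sum>d=1..N. real d powr (- 1 - \<epsilon>)) \<le> Z" for N
    unfolding Z_def by (rule sum_le_suminf[OF sZ]) auto
  have Z0: "Z \<ge> 0" using Z[of 0] by simp
  have "piltz_sum t N \<le> Z ^ t * real N powr (1 + \<epsilon>)" for N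
  proof (induction t arbitrary: N)
    case 0
    show ?case
    proof (cases "N = 0")
      case False
      have "piltz_sum 0 N = (\<Sum>n\<in>{1}. real (piltz 0 n))"
        unfolding piltz_sum_def by (rule sum.mono_neutral_right) (use False in \<open>auto simp: piltz_order_0\<close>)
      moreover have "1 \<le> real N powr (1 + \<epsilon>)" using False assms by (intro ge_one_powr_ge_zero) auto
      ultimately show ?thesis by (simp add: piltz_order_0)
    qed (simp add: piltz_sum_def)
  next
    case (Suc t)
    have "piltz_sum (Suc t) N \<le> (\<Sum>d=1..N. Z ^ t * real N powr (1 + \<epsilon>) * real d powr (- 1 - \<epsilon>))"
      unfolding piltz_sum_Suc
    proof (rule sum_mono)
      fix d assume d: "d \<in> {1..N}"
      have "piltz_sum t (N div d) \<le> Z ^ t * real (N div d) powr (1 + \<epsilon>)" by (rule Suc.IH)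
      also have "\<dots> \<le> Z ^ t * (real N / real d) powr (1 + \<epsilon>)"
        using assms Z0 by (intro mult_left_mono powr_mono2 of_nat_div_le_of_nat) auto
      also have "(real N / real d) powr (1 + \<epsilon>) = real N powr (1 + \<epsilon>) * real d powr (- 1 - \<epsilon>)"
        using d by (simp add: powr_divide powr_minus_divide[symmetric] divide_powr_uminus)
      finally show "piltz_sum t (N div d) \<le> Z ^ t * real N powr (1 + \<epsilon>) * real d powr (- 1 - \<epsilon>)"
        by (simp add: mult_ac)
    qed
    also have "\<dots> = Z ^ t * real N powr (1 + \<epsilon>) * (\<Sum>d=1..N. real d powr (- 1 - \<epsilon>))"
      by (simp add: sum_distrib_left)
    also have "\<dots> \<le> Z ^ t * real N powr (1 + \<epsilon>) * Z"
      using Z0 Z by (intro mult_left_mono) auto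
    finally show ?case by (simp add: mult_ac)
  qed
  then show ?thesis using Z0 by (intro that[of "Z ^ t"]) auto
qed

section \<open>Polynomials in logarithms against small powers\<close>

lemma linear_le_exp:
  assumes "(\<epsilon>::real) > 0"
  shows "\<bar>l\<bar> \<le> (1 / \<epsilon>) * exp (\<epsilon> * \<bar>l\<bar>)"
proof -
  have "\<epsilon> * \<bar>l\<bar> \<le> exp (\<epsilon> * \<bar>l\<bar>)" using exp_ge_add_one_self[of "\<epsilon> * \<bar>l\<bar>"] by linarith
  then show ?thesis using assms by (simp add: field_simps)
qed

text \<open>The induction splits \<epsilon>: one half pays for the new factor u, the other for the
  remaining polynomial.\<close>

lemma poly_le_exp:
  fixes P :: "real poly"
  assumes "\<epsilon> > 0"
  shows "\<exists>C\<ge>0. \<forall>u. \<bar>poly P u\<bar> \<le> C * exp (\<epsilon> * \<bar>u\<bar>)"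
  using assms
proof (induction P arbitrary: \<epsilon>)
  case 0
  then show ?case by (intro exI[of _ 0]) auto
next
  case (pCons a P)
  then obtain C where C: "C \<ge> 0" "\<And>u. \<bar>poly P u\<bar> \<le> C * exp (\<epsilon> / 2 * \<bar>u\<bar>)"
    using half_gt_zero by blast
  have "\<bar>poly (pCons a P) u\<bar> \<le> (\<bar>a\<bar> + 2 / \<epsilon> * C) * exp (\<epsilon> * \<bar>u\<bar>)" for u
  proof -
    have "\<bar>poly (pCons a P) u\<bar> \<le> \<bar>a\<bar> * 1 + \<bar>u\<bar> * \<bar>poly P u\<bar>"
      by (simp add: abs_mult[symmetric] abs_triangle_ineq)
    also have "\<dots> \<le> \<bar>a\<bar> * exp (\<epsilon> * \<bar>u\<bar>) + (1 / (\<epsilon> / 2) * exp (\<epsilon> / 2 * \<bar>u\<bar>)) * (C * exp (\<epsilon> / 2 * \<bar>u\<bar>))"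
      using pCons.prems C by (intro add_mono mult_mono linear_le_exp) auto
    also have "\<dots> = (\<bar>a\<bar> + 2 / \<epsilon> * C) * exp (\<epsilon> * \<bar>u\<bar>)"
      by (simp add: exp_add[symmetric] algebra_simps flip: exp_add)
    finally show ?thesis .
  qed
  then show ?case using C(1) pCons.prems by (intro exI[of _ "\<bar>a\<bar> + 2 / \<epsilon> * C"]) auto
qed

text \<open>Both powers appear because y may lie on either side of 1.\<close>

lemma exp_abs_ln_le:
  assumes "(y::real) > 0" "\<epsilon> > 0"
  shows "exp (\<epsilon> * \<bar>ln y\<bar>) \<le> y powr \<epsilon> + y powr (- \<epsilon>)"
  using assms by (cases "ln y \<ge> 0") (simp_all add: powr_def abs_if)

text \<open>With l = log d, the coefficients of P(u - log d) grow more slowly than any power of d,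
  so they do not disturb the convergence of the sum over d.\<close>

lemma coeff_pcompose_shift_le_exp:
  fixes P :: "real poly"
  assumes "\<epsilon> > 0"
  shows "\<exists>C\<ge>0. \<forall>l. \<bar>coeff (pcompose P [:- l, 1:]) k\<bar> \<le> C * exp (\<epsilon> * \<bar>l\<bar>)"
  using assms
proof (induction P arbitrary: \<epsilon> k)
  case 0
  then show ?case by (intro exI[of _ 0]) auto
next
  case (pCons a P)
  define R where "R = (\<lambda>l. pcompose P [:- l, 1:])"
  \<comment> \<open>This coefficient gets multiplied by l, hence \<epsilon>/2; the one of index k -
    1 enters without such a factor and may use all of \<epsilon>.\<close>
  obtain C where C: "C \<ge> 0" "\<And>l. \<bar>coeff (R l) k\<bar> \<le> C * exp (\<epsilon> / 2 * \<bar>l\<bar>)"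
    using pCons.IH[of "\<epsilon> / 2" k] pCons.prems by (auto simp: R_def)
  obtain D where D: "D \<ge> 0" "\<And>l. \<bar>coeff (R l) (k - 1)\<bar> \<le> D * exp (\<epsilon> * \<bar>l\<bar>)"
    using pCons.IH[of \<epsilon> "k - 1"] pCons.prems by (auto simp: R_def)
  have "\<bar>coeff (pcompose (pCons a P) [:- l, 1:]) k\<bar> \<le> (\<bar>a\<bar> + 2 / \<epsilon> * C + D) * exp (\<epsilon> * \<bar>l\<bar>)" for l
  proof -
    have "pcompose (pCons a P) [:- l, 1:] = [:a:] + (smult (- l) (R l) + pCons 0 (R l))"
      by (simp add: pcompose_pCons R_def)
    then have "coeff (pcompose (pCons a P) [:- l, 1:]) k
        = coeff [:a:] k - l * coeff (R l) k + (if k = 0 then 0 else coeff (R l) (k - 1))"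
      by (simp add: coeff_pCons split: nat.split)
    also have "\<bar>\<dots>\<bar> \<le> \<bar>a\<bar> * 1 + \<bar>l\<bar> * \<bar>coeff (R l) k\<bar> + \<bar>coeff (R l) (k - 1)\<bar>"
    proof -
      have tri: "\<bar>x - y + z\<bar> \<le> A + B + C" if "\<bar>x\<bar> \<le> A" "\<bar>y\<bar> \<le> B" "\<bar>z\<bar> \<le> C" for x y z A B C :: real
        using that by linarith
      show ?thesis
        by (rule tri) (simp_all add: abs_mult coeff_pCons split: nat.split)
    qed
    also have "\<dots> \<le> \<bar>a\<bar> * exp (\<epsilon> * \<bar>l\<bar>)
        + (1 / (\<epsilon> / 2) * exp (\<epsilon> / 2 * \<bar>l\<bar>)) * (C * exp (\<epsilon> / 2 * \<bar>l\<bar>)) + D * exp (\<epsilon> * \<bar>l\<bar>)"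
      using pCons.prems C D by (intro add_mono mult_mono linear_le_exp) auto
    also have "\<dots> = (\<bar>a\<bar> + 2 / \<epsilon> * C + D) * exp (\<epsilon> * \<bar>l\<bar>)"
      by (simp add: algebra_simps flip: exp_add)
    finally show ?thesis .
  qed
  then show ?case using C(1) D(1) pCons.prems by (intro exI[of _ "\<bar>a\<bar> + 2 / \<epsilon> * C + D"]) auto
qed

lemma coeff_prod_pcompose_shift_le_exp:
  fixes P :: "'a \<Rightarrow> real poly"
  assumes "finite I" "\<epsilon> > 0"
  shows "\<exists>C\<ge>0. \<forall>l. \<bar>coeff (\<Prod>i\<in>I. pcompose (P i) [:- l i, 1:]) k\<bar> \<le> C * (\<Prod>i\<in>I. exp (\<epsilon> * \<bar>l i\<bar>))"
  using assms(1)
proof (induction I arbitrary: k rule: finite_induct)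
  case empty
  then show ?case by (intro exI[of _ 1]) (simp add: coeff_1)
next
  case (insert x I)
  obtain C where "\<forall>k. C k \<ge> 0 \<and> (\<forall>l. \<bar>coeff (pcompose (P x) [:- l, 1:]) k\<bar> \<le> C k * exp (\<epsilon> * \<bar>l\<bar>))"
    using choice[OF allI[OF coeff_pcompose_shift_le_exp[OF assms(2), of "P x"]]] by (rule exE)
  then have C: "\<And>k. C k \<ge> 0" "\<And>k l. \<bar>coeff (pcompose (P x) [:- l, 1:]) k\<bar> \<le> C k * exp (\<epsilon> * \<bar>l\<bar>)"
    by simp_all
  obtain D where
    "\<forall>k. D k \<ge> 0 \<and> (\<forall>l. \<bar>coeff (\<Prod>i\<in>I. pcompose (P i) [:- l i, 1:]) k\<bar> \<le> D k * (\<Prod>i\<in>I. exp (\<epsilon> * \<bar>l i\<bar>)))"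
    using choice[OF allI[OF insert.IH]] by (rule exE)
  then have D: "\<And>k. D k \<ge> 0"
    "\<And>k l. \<bar>coeff (\<Prod>i\<in>I. pcompose (P i) [:- l i, 1:]) k\<bar> \<le> D k * (\<Prod>i\<in>I. exp (\<epsilon> * \<bar>l i\<bar>))"
    by simp_all
  have "\<bar>coeff (\<Prod>i\<in>insert x I. pcompose (P i) [:- l i, 1:]) k\<bar>
      \<le> (\<Sum>j\<le>k. C j * D (k - j)) * (\<Prod>i\<in>insert x I. exp (\<epsilon> * \<bar>l i\<bar>))" for l
  proof -
    have "\<bar>coeff (\<Prod>i\<in>insert x I. pcompose (P i) [:- l i, 1:]) k\<bar>
        \<le> (\<Sum>j\<le>k. \<bar>coeff (pcompose (P x) [:- l x, 1:]) j\<bar> * \<bar>coeff (\<Prod>i\<in>I. pcompose (P i) [:- l i, 1:]) (k - j)\<bar>)"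
      using insert.hyps by (simp add: coeff_mult abs_mult[symmetric])
    also have "\<dots> \<le> (\<Sum>j\<le>k. (C j * exp (\<epsilon> * \<bar>l x\<bar>)) * (D (k - j) * (\<Prod>i\<in>I. exp (\<epsilon> * \<bar>l i\<bar>))))"
      using C D by (intro sum_mono mult_mono) auto
    also have "\<dots> = (\<Sum>j\<le>k. C j * D (k - j)) * (\<Prod>i\<in>insert x I. exp (\<epsilon> * \<bar>l i\<bar>))"
      using insert.hyps by (simp add: sum_distrib_left sum_distrib_right mult_ac)
    finally show ?thesis .
  qed
  moreover have "(\<Sum>j\<le>k. C j * D (k - j)) \<ge> 0" using C D by (intro sum_nonneg) auto
  ultimately show ?case by blast
qed

text \<open>Factors are exchanged one at a time. The common majorant \<open>c\<close> of old and new
  factors makes the bound independent of the order of exchange.\<close>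

lemma abs_prod_diff_le:
  fixes a b c :: "'a \<Rightarrow> real"
  assumes "finite I" "\<And>i. i \<in> I \<Longrightarrow> \<bar>a i\<bar> \<le> c i" "\<And>i. i \<in> I \<Longrightarrow> \<bar>b i\<bar> \<le> c i"
  shows "\<bar>(\<Prod>i\<in>I. a i) - (\<Prod>i\<in>I. b i)\<bar> \<le> (\<Sum>i\<in>I. \<bar>a i - b i\<bar> * (\<Prod>j\<in>I - {i}. c j))"
  using assms
proof (induction I rule: finite_induct)
  case (insert x I)
  have c: "c i \<ge> 0" if "i \<in> insert x I" for i using insert.prems(1)[OF that] by linarith
  have "(\<Prod>i\<in>insert x I. a i) - (\<Prod>i\<in>insert x I. b i)
      = (a x - b x) * (\<Prod>i\<in>I. a i) + b x * ((\<Prod>i\<in>I. a i) - (\<Prod>i\<in>I. b i))"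
    using insert.hyps by (simp add: algebra_simps)
  also have "\<bar>\<dots>\<bar> \<le> \<bar>a x - b x\<bar> * \<bar>\<Prod>i\<in>I. a i\<bar> + \<bar>b x\<bar> * \<bar>(\<Prod>i\<in>I. a i) - (\<Prod>i\<in>I. b i)\<bar>"
    by (rule order_trans[OF abs_triangle_ineq]) (simp add: abs_mult)
  also have "\<dots> \<le> \<bar>a x - b x\<bar> * (\<Prod>j\<in>I. c j) + c x * (\<Sum>i\<in>I. \<bar>a i - b i\<bar> * (\<Prod>j\<in>I - {i}. c j))"
    using insert.prems insert.IH c unfolding abs_prod
    by (intro add_mono mult_mono prod_mono sum_nonneg) (auto intro!: mult_nonneg_nonneg prod_nonneg)
  also have "(\<Prod>j\<in>I. c j) = (\<Prod>j\<in>insert x I - {x}. c j)" using insert.hyps by simp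
  also have "c x * (\<Sum>i\<in>I. \<bar>a i - b i\<bar> * (\<Prod>j\<in>I - {i}. c j))
      = (\<Sum>i\<in>I. \<bar>a i - b i\<bar> * (\<Prod>j\<in>insert x I - {i}. c j))"
    unfolding sum_distrib_left
  proof (intro sum.cong refl)
    fix i assume i: "i \<in> I"
    then have "insert x I - {i} = insert x (I - {i})" using insert.hyps by auto
    then show "c x * (\<bar>a i - b i\<bar> * (\<Prod>j\<in>I - {i}. c j)) = \<bar>a i - b i\<bar> * (\<Prod>j\<in>insert x I - {i}. c j)"
      using insert.hyps by simp
  qed
  finally show ?case using insert.hyps by simp
qed simp

lemma nat_floor_divide:
  assumes "x \<ge> 0"
  shows "nat \<lfloor>x\<rfloor> div d = nat \<lfloor>x / real d\<rfloor>"
proof -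
  have "\<lfloor>x / real_of_int (int d)\<rfloor> = \<lfloor>x\<rfloor> div int d" by (rule floor_divide_real_eq_div) simp
  then show ?thesis using assms by (simp add: nat_div_distrib)
qed

text \<open>The summatory function jumps by at least $1$ at every integer, while its main term is continuous.\<close>

lemma piltz_exponent_nonneg:
  assumes "piltz_exponent t \<theta>" "t > 0"
  shows "\<theta> \<ge> 0"
proof (rule ccontr)
  assume neg: "\<not> \<theta> \<ge> 0"
  obtain P where P: "\<And>\<epsilon>. \<epsilon> > 0 \<Longrightarrow> (\<lambda>x. piltz_sum t (nat \<lfloor>x\<rfloor>) - x * poly P (ln x)) \<in> O[at_top](\<lambda>x. x powr (\<theta> + \<epsilon>))"
    using assms(1) unfolding piltz_exponent_def piltz_sum_def by blast
  define E where "E = (\<lambda>x::real. piltz_sum t (nat \<lfloor>x\<rfloor>) - x * poly P (ln x))"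
  \<comment> \<open>Taking \<epsilon> = -\<theta>/2 leaves the negative exponent \<theta>/2, so the
    remainder tends to 0.\<close>
  have "E \<in> O[at_top](\<lambda>x. x powr (\<theta> / 2))"
    using P[of "- \<theta> / 2"] neg by (simp add: E_def)
  then obtain c where c: "eventually (\<lambda>x. norm (E x) \<le> c * norm (x powr (\<theta> / 2))) at_top"
    by (rule landau_o.bigE)
  have "((\<lambda>x::real. c * norm (x powr (\<theta> / 2))) \<longlongrightarrow> c * norm (0::real)) at_top"
    using neg by (intro tendsto_mult tendsto_const tendsto_norm tendsto_neg_powr filterlim_ident) simp
  \<comment> \<open>Three quantities below 1/4, the remainders at x and at N and the change of the
    main term, cannot add up to a jump of at least 1.\<close>
  then have "eventually (\<lambda>x. c * norm (x powr (\<theta> / 2)) < 1 / 4) at_top"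
    by (rule order_tendstoD) simp
  with c have "eventually (\<lambda>x. \<bar>E x\<bar> < 1 / 4) at_top"
    by eventually_elim simp
  then obtain x0 where x0: "\<And>x. x \<ge> x0 \<Longrightarrow> \<bar>E x\<bar> < 1 / 4" by (auto simp: eventually_at_top_linorder)
  \<comment> \<open>The added 2 puts the whole interval (N - 1, N) beyond x0 and keeps N positive,
    where the logarithm is continuous.\<close>
  define N where "N = nat \<lceil>max x0 0\<rceil> + 2"
  have N: "real N \<ge> x0 + 1" "N \<ge> 2" unfolding N_def by linarith+
  define g where "g = (\<lambda>x. x * poly P (ln x))"
  have "isCont g (real N)" unfolding g_def using N by (intro continuous_intros) auto
  then have "(g \<longlongrightarrow> g (real N)) (at_left (real N))"
    by (simp add: isCont_def filterlim_at_split)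
  then have "eventually (\<lambda>x. dist (g x) (g (real N)) < 1 / 4) (at_left (real N))"
    by (rule tendstoD) simp
  then have "eventually (\<lambda>x. \<bar>g x - g (real N)\<bar> < 1 / 4) (at_left (real N))"
    by (simp only: dist_real_def)
  moreover have "eventually (\<lambda>x. x \<in> {real N - 1<..<real N}) (at_left (real N))"
    by (rule eventually_at_left_real) simp
  ultimately have "eventually (\<lambda>x. \<bar>g x - g (real N)\<bar> < 1 / 4 \<and> x \<in> {real N - 1<..<real N}) (at_left (real N))"
    by (rule eventually_conj)
  then obtain x where x: "\<bar>g x - g (real N)\<bar> < 1 / 4" "real N - 1 < x" "x < real N"
    using eventually_happens by (fastforce simp: trivial_limit_at_left_real)
  have "\<lfloor>x\<rfloor> = int (N - 1)" using x N by (intro floor_unique) (auto simp: of_nat_diff)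
  then have fl: "nat \<lfloor>x\<rfloor> = N - 1" by simp
  have "piltz_sum t N = piltz_sum t (N - 1) + real (piltz t N)"
    using N by (cases N) (simp_all add: piltz_sum_def)
  moreover have "real (piltz t N) \<ge> 1" using piltz_pos[of t N] assms(2) N by linarith
  moreover have "\<bar>E x\<bar> < 1 / 4" "\<bar>E (real N)\<bar> < 1 / 4" using x0 x N by auto
  moreover have "E x = piltz_sum t (N - 1) - g x" "E (real N) = piltz_sum t N - g (real N)"
    by (simp_all add: E_def g_def fl)
  ultimately show False using x(1) by linarith
qed

section \<open>The asymptotic formula\<close>

lemma piltz_sum_floor_bound:
  assumes "\<epsilon> > 0"
  obtains C where "C \<ge> 0" "\<And>y. y \<ge> 0 \<Longrightarrow> piltz_sum t (nat \<lfloor>y\<rfloor>) \<le> C * y powr (1 + \<epsilon>)"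
proof -
  obtain C where C: "C \<ge> 0" "\<And>N. piltz_sum t N \<le> C * real N powr (1 + \<epsilon>)"
    using piltz_sum_bound[OF assms] by blast
  have "piltz_sum t (nat \<lfloor>y\<rfloor>) \<le> C * y powr (1 + \<epsilon>)" if "y \<ge> 0" for y
  proof -
    have "real (nat \<lfloor>y\<rfloor>) \<le> y" using that by (rule of_nat_floor)
    then have "real (nat \<lfloor>y\<rfloor>) powr (1 + \<epsilon>) \<le> y powr (1 + \<epsilon>)"
      using assms by (intro powr_mono2) auto
    with C show ?thesis by (meson mult_left_mono order_trans)
  qed
  with C(1) show ?thesis using that by blast
qed

text \<open>Extends the asymptotic estimate to all y > 0. Below a threshold the crude bounds
  suffice, since a <= 1 - \<epsilon> makes y^(1+\<epsilon>) and y^(1-\<epsilon>) bounded multiples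
  of y^a there.\<close>

lemma piltz_main_remainder_bounds:
  fixes P :: "real poly"
  assumes "\<epsilon> > 0" "a \<le> 1 - \<epsilon>"
    and O: "(\<lambda>x. piltz_sum t (nat \<lfloor>x\<rfloor>) - x * poly P (ln x)) \<in> O[at_top](\<lambda>x. x powr a)"
  shows "\<exists>C\<ge>0. \<forall>y>0.
    \<bar>piltz_sum t (nat \<lfloor>y\<rfloor>)\<bar> \<le> C * (y powr (1 + \<epsilon>) + y powr (1 - \<epsilon>)) \<and>
    \<bar>y * poly P (ln y)\<bar> \<le> C * (y powr (1 + \<epsilon>) + y powr (1 - \<epsilon>)) \<and>
    \<bar>piltz_sum t (nat \<lfloor>y\<rfloor>) - y * poly P (ln y)\<bar> \<le> C * y powr a"
proof -
  obtain C1 where C1: "C1 \<ge> 0" "\<And>y. y \<ge> 0 \<Longrightarrow> piltz_sum t (nat \<lfloor>y\<rfloor>) \<le> C1 * y powr (1 + \<epsilon>)"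
    using piltz_sum_floor_bound[OF assms(1)] by blast
  obtain C2 where C2: "C2 \<ge> 0" "\<And>u. \<bar>poly P u\<bar> \<le> C2 * exp (\<epsilon> * \<bar>u\<bar>)"
    using poly_le_exp[OF assms(1)] by blast
  obtain c where "eventually (\<lambda>x. norm (piltz_sum t (nat \<lfloor>x\<rfloor>) - x * poly P (ln x)) \<le> c * norm (x powr a)) at_top"
    using O by (rule landau_o.bigE)
  then obtain y1 where y1: "\<And>y. y \<ge> y1 \<Longrightarrow> \<bar>piltz_sum t (nat \<lfloor>y\<rfloor>) - y * poly P (ln y)\<bar> \<le> c * y powr a"
    by (auto simp: eventually_at_top_linorder)
  define y0 where "y0 = max y1 1"
  \<comment> \<open>The exponents 1 + \<epsilon> - a and 1 - \<epsilon> - a are nonnegative, so on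
    (0, y0] both powers are largest at y0.\<close>
  define C3 where "C3 = (C1 + C2) * (y0 powr (1 + \<epsilon> - a) + y0 powr (1 - \<epsilon> - a))"
  define C where "C = C1 + C2 + C3 + \<bar>c\<bar>"
  have C3: "C3 \<ge> 0" using C1 C2 by (simp add: C3_def)
  have S: "\<bar>piltz_sum t (nat \<lfloor>y\<rfloor>)\<bar> \<le> C1 * (y powr (1 + \<epsilon>) + y powr (1 - \<epsilon>))" if "y > 0" for y
  proof -
    have "\<bar>piltz_sum t (nat \<lfloor>y\<rfloor>)\<bar> \<le> C1 * y powr (1 + \<epsilon>)"
      using C1(2)[of y] that by (simp add: piltz_sum_nonneg)
    also have "\<dots> \<le> C1 * (y powr (1 + \<epsilon>) + y powr (1 - \<epsilon>))"
      using C1(1) by (intro mult_left_mono) auto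
    finally show ?thesis .
  qed
  have M: "\<bar>y * poly P (ln y)\<bar> \<le> C2 * (y powr (1 + \<epsilon>) + y powr (1 - \<epsilon>))" if y: "y > 0" for y
  proof -
    have "\<bar>y * poly P (ln y)\<bar> \<le> y * (C2 * exp (\<epsilon> * \<bar>ln y\<bar>))"
      unfolding abs_mult using y C2 by (intro mult_mono) auto
    also have "\<dots> \<le> y * (C2 * (y powr \<epsilon> + y powr (- \<epsilon>)))"
      using y C2 assms(1) by (intro mult_left_mono exp_abs_ln_le) auto
    also have "\<dots> = C2 * (y powr 1 * y powr \<epsilon> + y powr 1 * y powr (- \<epsilon>))"
      using y by (simp add: algebra_simps)
    also have "\<dots> = C2 * (y powr (1 + \<epsilon>) + y powr (1 - \<epsilon>))"
      by (simp only: powr_add[symmetric] add_uminus_conv_diff)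
    finally show ?thesis .
  qed
  have R: "\<bar>piltz_sum t (nat \<lfloor>y\<rfloor>) - y * poly P (ln y)\<bar> \<le> (C3 + \<bar>c\<bar>) * y powr a" if y: "y > 0" for y
  proof (cases "y \<ge> y0")
    case True
    then have "\<bar>piltz_sum t (nat \<lfloor>y\<rfloor>) - y * poly P (ln y)\<bar> \<le> c * y powr a" by (intro y1) (simp add: y0_def)
    also have "\<dots> \<le> (C3 + \<bar>c\<bar>) * y powr a" using C3 by (intro mult_right_mono) auto
    finally show ?thesis .
  next
    case False
    have split: "y powr b = y powr (b - a) * y powr a" for b by (simp flip: powr_add)
    have "\<bar>piltz_sum t (nat \<lfloor>y\<rfloor>) - y * poly P (ln y)\<bar>
        \<le> (C1 + C2) * (y powr (1 + \<epsilon>) + y powr (1 - \<epsilon>))"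
      using S[OF y] M[OF y] by (simp add: ring_distribs abs_le_iff)
    also have "\<dots> = (C1 + C2) * (y powr (1 + \<epsilon> - a) + y powr (1 - \<epsilon> - a)) * y powr a"
      by (subst split[of "1 + \<epsilon>"], subst split[of "1 - \<epsilon>"]) (simp add: algebra_simps)
    also have "\<dots> \<le> C3 * y powr a"
      unfolding C3_def using False y assms(1,2) C1 C2
      by (intro mult_right_mono mult_left_mono add_mono powr_mono2) auto
    also have "\<dots> \<le> (C3 + \<bar>c\<bar>) * y powr a" by (intro mult_right_mono) auto
    finally show ?thesis .
  qed
  have le: "K * z \<le> C * z" if "z \<ge> 0" "K \<le> C" for K z :: real
    using that by (rule mult_right_mono[rotated])
  show ?thesis
  proof (intro exI[of _ C] conjI allI impI)
    show "C \<ge> 0" using C1 C2 C3 by (simp add: C_def)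
    fix y :: real assume y: "y > 0"
    show "\<bar>piltz_sum t (nat \<lfloor>y\<rfloor>)\<bar> \<le> C * (y powr (1 + \<epsilon>) + y powr (1 - \<epsilon>))"
      by (rule order_trans[OF S[OF y] le]) (use C1 C2 C3 in \<open>auto simp: C_def\<close>)
    show "\<bar>y * poly P (ln y)\<bar> \<le> C * (y powr (1 + \<epsilon>) + y powr (1 - \<epsilon>))"
      by (rule order_trans[OF M[OF y] le]) (use C1 C2 C3 in \<open>auto simp: C_def\<close>)
    show "\<bar>piltz_sum t (nat \<lfloor>y\<rfloor>) - y * poly P (ln y)\<bar> \<le> C * y powr a"
      by (rule order_trans[OF R[OF y] le]) (use C1 C2 C3 in \<open>auto simp: C_def\<close>)
  qed
qed

section \<open>Reduction of the coprime sum to Piltz sums\<close>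

context coprime_sieve
begin

definition coprime_sum :: "real \<Rightarrow> real" where
  "coprime_sum x = (\<Sum>m\<in>{m \<in> I \<rightarrow>\<^sub>E {1..nat \<lfloor>x\<rfloor>}. pairwise (\<lambda>i j. coprime (m i) (m j)) I}.
     \<Prod>i\<in>I. real (piltz (t i) (m i)))"

lemma coprime_sum_nonneg: "coprime_sum x \<ge> 0"
  by (simp add: coprime_sum_def sum_nonneg prod_nonneg)

text \<open>Dropping coprimality is affordable when some exponent is at least 1, where only the
  order of magnitude matters.\<close>

lemma coprime_sum_le: "coprime_sum x \<le> (\<Prod>i\<in>I. piltz_sum (t i) (nat \<lfloor>x\<rfloor>))"
proof -
  have "coprime_sum x \<le> (\<Sum>m\<in>I \<rightarrow>\<^sub>E {1..nat \<lfloor>x\<rfloor>}. \<Prod>i\<in>I. real (piltz (t i) (m i)))"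
    unfolding coprime_sum_def by (intro sum_mono2 finite_PiE) (auto simp: prod_nonneg)
  also have "\<dots> = (\<Prod>i\<in>I. piltz_sum (t i) (nat \<lfloor>x\<rfloor>))"
    unfolding piltz_sum_def by (rule prod_sum_PiE[symmetric]) auto
  finally show ?thesis .
qed

text \<open>A common prime factor of two entries is at most floor(x) < n, so testing the primes
  below n decides coprimality.\<close>

lemma coprime_sum_eq_euler_sum:
  assumes "n > nat \<lfloor>x\<rfloor>" "x \<ge> 0"
  shows "coprime_sum x = euler_sum exps h n (\<lambda>d. \<Prod>i\<in>I. piltz_sum (t i) (nat \<lfloor>x / real (d i)\<rfloor>))"
proof -
  let ?B = "I \<rightarrow>\<^sub>E {1..nat \<lfloor>x\<rfloor>}"
  have eq: "pairwise (\<lambda>i j. coprime (m i) (m j)) I \<longleftrightarrow> coprime_below n m" if m: "m \<in> ?B" for m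
  proof -
    have "coprime (m i) (m j) \<longleftrightarrow> (\<forall>p<n. prime p \<longrightarrow> \<not> (p dvd m i \<and> p dvd m j))"
      if "i \<in> I" "j \<in> I" for i j
    proof
      assume "coprime (m i) (m j)"
      then show "\<forall>p<n. prime p \<longrightarrow> \<not> (p dvd m i \<and> p dvd m j)"
        using coprime_common_divisor not_prime_unit by blast
    next
      assume *: "\<forall>p<n. prime p \<longrightarrow> \<not> (p dvd m i \<and> p dvd m j)"
      show "coprime (m i) (m j)"
      proof (rule ccontr)
        assume "\<not> coprime (m i) (m j)"
        then have "gcd (m i) (m j) \<noteq> 1" by (simp add: coprime_iff_gcd_eq_1)
        then obtain p where p: "prime p" "p dvd gcd (m i) (m j)" using prime_factor_nat by blast
        have "m i \<ge> 1" "m i \<le> nat \<lfloor>x\<rfloor>" using m that by (auto simp: PiE_def Pi_def)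
        moreover have "p dvd m i" "p dvd m j" using p by auto
        ultimately have "p < n" using assms(1) dvd_imp_le[of p "m i"] by linarith
        with * p(1) \<open>p dvd m i\<close> \<open>p dvd m j\<close> show False by blast
      qed
    qed
    then show ?thesis unfolding coprime_below_def pairwise_def by blast
  qed
  have "finite ?B" by (intro finite_PiE) auto
  then have "coprime_sum x = (\<Sum>m\<in>?B. if pairwise (\<lambda>i j. coprime (m i) (m j)) I then \<Prod>i\<in>I. real (piltz (t i) (m i)) else 0)"
    unfolding coprime_sum_def by (rule sum.inter_filter)
  also have "\<dots> = (\<Sum>m\<in>?B. (\<Prod>i\<in>I. real (piltz (t i) (m i))) * of_bool (coprime_below n m))"
    by (intro sum.cong refl) (simp add: eq)
  also have "\<dots> = euler_sum exps h n (\<lambda>d. \<Prod>i\<in>I. piltz_sum (t i) (nat \<lfloor>x\<rfloor> div d i))"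
    unfolding piltz_sum_def by (rule sum_coprime_below)
  finally show ?thesis by (simp add: nat_floor_divide assms(2))
qed

section \<open>The main term as a polynomial in log x\<close>

context
  fixes P :: "nat \<Rightarrow> real poly"
  assumes P_nonzero: "i \<in> I \<Longrightarrow> P i \<noteq> 0"
begin

text \<open>As a polynomial in u = log x this is the product of the P_i(log(x/d_i)); keeping log x
  as the variable leaves the dependence on d in the coefficients.\<close>

definition shifted :: "(nat \<Rightarrow> nat) \<Rightarrow> real poly" where
  "shifted d = (\<Prod>i\<in>I. pcompose (P i) [:- ln (real (d i)), 1:])"

definition main_degree :: nat where
  "main_degree = (\<Sum>i\<in>I. degree (P i))"

definition main_coeff :: "nat \<Rightarrow> nat \<Rightarrow> real" where
  "main_coeff n k = euler_sum exps h n (\<lambda>d. coeff (shifted d) k * wpow (\<lambda>_. 1) d)"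

definition main_poly :: "real poly" where
  "main_poly = (\<Sum>k\<le>main_degree. monom (lim (\<lambda>n. main_coeff n k)) k)"

lemma pcompose_shift_nonzero: "i \<in> I \<Longrightarrow> pcompose (P i) [:- l, 1:] \<noteq> 0"
  using P_nonzero by (simp add: pcompose_eq_0_iff)

lemma degree_shifted: "degree (shifted d) = main_degree"
  unfolding shifted_def main_degree_def
  by (subst degree_prod_eq_sum_degree) (auto simp: pcompose_shift_nonzero degree_pcompose)

text \<open>A shift of the variable preserves leading coefficients, so the top coefficient does not
  depend on d and leaves a pure Euler product.\<close>

lemma coeff_shifted_top: "coeff (shifted d) main_degree = (\<Prod>i\<in>I. lead_coeff (P i))"
proof -
  have "coeff (shifted d) main_degree = lead_coeff (shifted d)" by (simp add: degree_shifted)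
  also have "\<dots> = (\<Prod>i\<in>I. lead_coeff (P i))"
    unfolding shifted_def lead_coeff_prod by (intro prod.cong refl) (simp add: lead_coeff_comp)
  finally show ?thesis .
qed

lemma main_coeff_top: "main_coeff n main_degree = (\<Prod>i\<in>I. lead_coeff (P i)) * (\<Prod>p<n. if prime p then local_factor p else 1)"
  unfolding main_coeff_def coeff_shifted_top euler_sum_scale euler_sum_wpow_one ..

lemma convergent_main_coeff: "convergent (\<lambda>n. main_coeff n k)"
proof -
  \<comment> \<open>Spending d_i^(1/4) on the logarithms lowers the exponent 1 to 3/4, and 3/4 + 3/4
    = 1 + 1/2.\<close>
  have adm: "admissible (1/2) (\<lambda>_. 3/4)" by (simp add: admissible_def)
  obtain C where C: "C \<ge> 0"
    "\<And>l. \<bar>coeff (\<Prod>i\<in>I. pcompose (P i) [:- l i, 1:]) k\<bar> \<le> C * (\<Prod>i\<in>I. exp (1/4 * \<bar>l i\<bar>))"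
    using coeff_prod_pcompose_shift_le_exp[OF finite_I, of "1/4" P k] by auto
  show ?thesis
    unfolding main_coeff_def
  proof (rule convergent_euler_sum[OF adm])
    fix d d' :: "nat \<Rightarrow> nat" assume "\<And>i. i \<in> I \<Longrightarrow> d i = d' i"
    then show "coeff (shifted d) k * wpow (\<lambda>_. 1) d = coeff (shifted d') k * wpow (\<lambda>_. 1) d'"
      by (simp add: shifted_def wpow_def)
  next
    fix d :: "nat \<Rightarrow> nat" assume d: "\<And>i. d i > 0"
    have "\<bar>coeff (shifted d) k * wpow (\<lambda>_. 1) d\<bar> \<le> C * (\<Prod>i\<in>I. exp (1/4 * \<bar>ln (real (d i))\<bar>)) * wpow (\<lambda>_. 1) d"
      unfolding abs_mult shifted_def using C(2)[of "\<lambda>i. ln (real (d i))"]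
      by (simp add: wpow_nonneg mult_right_mono)
    also have "\<dots> = C * (\<Prod>i\<in>I. exp (1/4 * \<bar>ln (real (d i))\<bar>) * real (d i) powr - 1)"
      by (simp only: wpow_def prod.distrib mult.assoc)
    also have "(\<Prod>i\<in>I. exp (1/4 * \<bar>ln (real (d i))\<bar>) * real (d i) powr - 1) = wpow (\<lambda>_. 3/4) d"
      unfolding wpow_def
    proof (intro prod.cong refl)
      fix i
      have "ln (real (d i)) \<ge> 0" using d[of i] by simp
      then have "exp (1/4 * \<bar>ln (real (d i))\<bar>) = real (d i) powr (1/4)"
        using d[of i] by (simp add: powr_def)
      then have "exp (1/4 * \<bar>ln (real (d i))\<bar>) * real (d i) powr - 1 = real (d i) powr (1/4 + - 1)"
        by (simp only: powr_add)
      then show "exp (1/4 * \<bar>ln (real (d i))\<bar>) * real (d i) powr - 1 = real (d i) powr - (3/4)"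
        by simp
    qed
    finally show "\<bar>coeff (shifted d) k * wpow (\<lambda>_. 1) d\<bar> \<le> C * wpow (\<lambda>_. 3/4) d" .
  qed
qed

lemma coeff_main_poly: "coeff main_poly k = (if k \<le> main_degree then lim (\<lambda>n. main_coeff n k) else 0)"
  by (simp add: main_poly_def coeff_sum)

lemma coeff_main_poly_top:
  "coeff main_poly main_degree = (\<Prod>i\<in>I. lead_coeff (P i)) * (\<Prod>p. if prime p then local_factor p else 1)"
proof -
  have "(\<lambda>n. \<Prod>p<n. if prime p then local_factor p else 1) \<longlonglongrightarrow> (\<Prod>p. if prime p then local_factor p else 1)"
    using convergent_prod_LIMSEQ[OF convergent_prod_local_factor]
    by (simp add: lessThan_Suc_atMost[symmetric] LIMSEQ_lessThan_iff_atMost)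
  then have "(\<lambda>n. main_coeff n main_degree) \<longlonglongrightarrow> (\<Prod>i\<in>I. lead_coeff (P i)) * (\<Prod>p. if prime p then local_factor p else 1)"
    unfolding main_coeff_top by (rule tendsto_mult_left)
  then show ?thesis by (simp add: coeff_main_poly limI)
qed

lemma degree_main_poly: "degree main_poly = main_degree"
proof (rule antisym)
  show "degree main_poly \<le> main_degree"
    by (rule degree_le) (simp add: coeff_main_poly)
  have "coeff main_poly main_degree \<noteq> 0"
    unfolding coeff_main_poly_top using P_nonzero prodinf_local_factor_nonzero by simp
  then show "main_degree \<le> degree main_poly" by (rule le_degree)
qed

lemma lead_coeff_main_poly:
  "lead_coeff main_poly = (\<Prod>i\<in>I. lead_coeff (P i)) * (\<Prod>p. if prime p then local_factor p else 1)"
  by (simp only: degree_main_poly coeff_main_poly_top)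

text \<open>An exact identity for every n: log(x/d_i) = log x - log d_i separates x from d, and the
  factors x/d_i give the power of x and the weight with all exponents 1.\<close>

lemma euler_sum_main:
  assumes "x > 0"
  shows "euler_sum exps h n (\<lambda>d. \<Prod>i\<in>I. x / real (d i) * poly (P i) (ln (x / real (d i))))
    = x ^ card I * (\<Sum>k\<le>main_degree. ln x ^ k * main_coeff n k)"
proof -
  have "euler_sum exps h n (\<lambda>d. \<Prod>i\<in>I. x / real (d i) * poly (P i) (ln (x / real (d i))))
      = euler_sum exps h n (\<lambda>d. x ^ card I * (\<Sum>k\<le>main_degree. ln x ^ k * (coeff (shifted d) k * wpow (\<lambda>_. 1) d)))"
  proof (rule euler_sum_cong)
    fix d :: "nat \<Rightarrow> nat" assume d: "\<And>i. d i > 0"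
    have "(\<Prod>i\<in>I. x / real (d i) * poly (P i) (ln (x / real (d i))))
        = (\<Prod>i\<in>I. x * (real (d i) powr - 1 * poly (pcompose (P i) [:- ln (real (d i)), 1:]) (ln x)))"
    proof (intro prod.cong refl)
      fix i
      have "ln (x / real (d i)) = ln x - ln (real (d i))"
        using assms d[of i] by (simp add: ln_div)
      then show "x / real (d i) * poly (P i) (ln (x / real (d i)))
          = x * (real (d i) powr - 1 * poly (pcompose (P i) [:- ln (real (d i)), 1:]) (ln x))"
        using d[of i] by (simp add: poly_pcompose powr_minus divide_inverse)
    qed
    also have "\<dots> = x ^ card I * (wpow (\<lambda>_. 1) d * poly (shifted d) (ln x))"
      by (simp only: prod.distrib wpow_def shifted_def poly_prod prod_constant)
    also have "poly (shifted d) (ln x) = (\<Sum>k\<le>main_degree. coeff (shifted d) k * ln x ^ k)"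
      by (simp add: poly_altdef degree_shifted)
    finally show "(\<Prod>i\<in>I. x / real (d i) * poly (P i) (ln (x / real (d i))))
        = x ^ card I * (\<Sum>k\<le>main_degree. ln x ^ k * (coeff (shifted d) k * wpow (\<lambda>_. 1) d))"
      by (simp add: sum_distrib_left mult_ac)
  qed
  also have "\<dots> = x ^ card I * (\<Sum>k\<le>main_degree. ln x ^ k * main_coeff n k)"
    unfolding main_coeff_def by (simp only: euler_sum_scale euler_sum_sum)
  finally show ?thesis .
qed

text \<open>The bound \<theta> + 3\<epsilon> <= 1 gives a <= 1 - \<epsilon> for a = \<theta> +
  2\<epsilon>, as the remainder bounds demand. The exponent of x collects a from the replaced factor
  and 1 + \<epsilon> from each of the others.\<close>

lemma coprime_sum_asymptotics:
  assumes \<epsilon>: "\<epsilon> > 0" "\<epsilon> \<le> 1/3" and \<theta>: "\<theta> \<ge> 0" "\<theta> + 3 * \<epsilon> \<le> 1"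
    and O: "\<And>i. i \<in> I \<Longrightarrow>
      (\<lambda>x. piltz_sum (t i) (nat \<lfloor>x\<rfloor>) - x * poly (P i) (ln x)) \<in> O[at_top](\<lambda>x. x powr (\<theta> + 2 * \<epsilon>))"
  shows "\<exists>C. \<forall>x\<ge>1. \<bar>coprime_sum x - x ^ card I * poly main_poly (ln x)\<bar>
    \<le> C * x powr (\<theta> + 2 * \<epsilon> + (real (card I) - 1) * (1 + \<epsilon>))"
proof -
  define a where "a = \<theta> + 2 * \<epsilon>"
  have a1: "a \<le> 1 - \<epsilon>" using \<theta> by (simp add: a_def)
  have "\<forall>i\<in>I. \<exists>C\<ge>0. \<forall>y>0.
    \<bar>piltz_sum (t i) (nat \<lfloor>y\<rfloor>)\<bar> \<le> C * (y powr (1 + \<epsilon>) + y powr (1 - \<epsilon>)) \<and>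
    \<bar>y * poly (P i) (ln y)\<bar> \<le> C * (y powr (1 + \<epsilon>) + y powr (1 - \<epsilon>)) \<and>
    \<bar>piltz_sum (t i) (nat \<lfloor>y\<rfloor>) - y * poly (P i) (ln y)\<bar> \<le> C * y powr a"
    using piltz_main_remainder_bounds[OF \<epsilon>(1) a1] O by (simp add: a_def)
  from bchoice[OF this] obtain c where c: "\<And>i. i \<in> I \<Longrightarrow> c i \<ge> 0"
    and c_bounds: "\<And>i y. i \<in> I \<Longrightarrow> y > 0 \<Longrightarrow>
    \<bar>piltz_sum (t i) (nat \<lfloor>y\<rfloor>)\<bar> \<le> c i * (y powr (1 + \<epsilon>) + y powr (1 - \<epsilon>)) \<and>
    \<bar>y * poly (P i) (ln y)\<bar> \<le> c i * (y powr (1 + \<epsilon>) + y powr (1 - \<epsilon>)) \<and>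
    \<bar>piltz_sum (t i) (nat \<lfloor>y\<rfloor>) - y * poly (P i) (ln y)\<bar> \<le> c i * y powr a"
    by (elim exE) blast
  \<comment> \<open>The 2 covers the two powers of y; the sum dominates every \<open>c i\<close> at
    once.\<close>
  define K where "K = 2 * (\<Sum>i\<in>I. c i)"
  have cK: "2 * c i \<le> K" if "i \<in> I" for i
    unfolding K_def using member_le_sum[OF that, of c] c by simp
  have K0: "K \<ge> 0" unfolding K_def using c by (simp add: sum_nonneg)
  \<comment> \<open>The weight left after replacing position i: \<open>a\<close> there, 1 -
    \<epsilon> at all others.\<close>
  define s where "s = (\<lambda>i j::nat. if j = i then a else 1 - \<epsilon>)"
  have adm: "admissible \<epsilon> (s i)" for i
    unfolding admissible_def s_def a_def using \<epsilon> \<theta> by (auto simp: algebra_simps)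
  have "\<forall>i. \<exists>B. \<forall>n. euler_sum exps (\<lambda>v. \<bar>h v\<bar>) n (wpow (s i)) \<le> B"
    using euler_sum_wpow_bounded[OF adm] by metis
  from choice[OF this] obtain B where B: "\<And>i n. euler_sum exps (\<lambda>v. \<bar>h v\<bar>) n (wpow (s i)) \<le> B i"
    by (elim exE) blast
  define e where "e = a + (real (card I) - 1) * (1 + \<epsilon>)"
  define C where "C = K ^ card I * (\<Sum>i\<in>I. B i)"
  have step: "\<bar>coprime_sum x - x ^ card I * (\<Sum>k\<le>main_degree. ln x ^ k * main_coeff n k)\<bar> \<le> C * x powr e"
    if x: "x \<ge> 1" and n: "n > nat \<lfloor>x\<rfloor>" for x n
  proof -
    let ?S = "\<lambda>d i. piltz_sum (t i) (nat \<lfloor>x / real (d i)\<rfloor>)"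
    let ?M = "\<lambda>d i. x / real (d i) * poly (P i) (ln (x / real (d i)))"
    \<comment> \<open>Common majorant of both powers of x/d_i: for d_i >= 1 one raises -(1 +
      \<epsilon>) to -(1 - \<epsilon>) in d_i, and for x >= 1 one raises 1 - \<epsilon> to 1 +
      \<epsilon> in x.\<close>
    let ?c = "\<lambda>d i. K * (x powr (1 + \<epsilon>) * real (d i) powr (- (1 - \<epsilon>)))"
    have pt: "\<bar>(\<Prod>i\<in>I. ?S d i) - (\<Prod>i\<in>I. ?M d i)\<bar> \<le> K ^ card I * x powr e * (\<Sum>i\<in>I. wpow (s i) d)"
      if d: "\<And>i. d i > 0" for d :: "nat \<Rightarrow> nat"
    proof -
      have d1: "real (d i) \<ge> 1" for i using d[of i] by simp
      have y0: "x / real (d i) > 0" for i using x d by simp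
      have pw: "(x / real (d i)) powr b = x powr b * real (d i) powr (- b)" for i b
        using x by (simp add: powr_divide powr_minus_divide)
      have mm: "c i * ((x / real (d i)) powr (1 + \<epsilon>) + (x / real (d i)) powr (1 - \<epsilon>)) \<le> ?c d i"
        if i: "i \<in> I" for i
      proof -
        have "(x / real (d i)) powr (1 + \<epsilon>) \<le> x powr (1 + \<epsilon>) * real (d i) powr (- (1 - \<epsilon>))"
          unfolding pw using x d1 \<epsilon> by (intro mult_left_mono powr_mono) auto
        moreover have "(x / real (d i)) powr (1 - \<epsilon>) \<le> x powr (1 + \<epsilon>) * real (d i) powr (- (1 - \<epsilon>))"
          unfolding pw using x d1 \<epsilon> by (intro mult_right_mono powr_mono) auto
        ultimately have "c i * ((x / real (d i)) powr (1 + \<epsilon>) + (x / real (d i)) powr (1 - \<epsilon>))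
            \<le> c i * (2 * (x powr (1 + \<epsilon>) * real (d i) powr (- (1 - \<epsilon>))))"
          using c[OF i] by (intro mult_left_mono) auto
        also have "\<dots> = 2 * c i * (x powr (1 + \<epsilon>) * real (d i) powr (- (1 - \<epsilon>)))" by simp
        also have "\<dots> \<le> ?c d i" using cK[OF i] by (intro mult_right_mono) auto
        finally show ?thesis .
      qed
      have "\<bar>(\<Prod>i\<in>I. ?S d i) - (\<Prod>i\<in>I. ?M d i)\<bar> \<le> (\<Sum>i\<in>I. \<bar>?S d i - ?M d i\<bar> * (\<Prod>j\<in>I - {i}. ?c d j))"
        by (rule abs_prod_diff_le[OF finite_I]) (use c_bounds[OF _ y0] mm in \<open>blast intro: order_trans\<close>)+
      also have "\<dots> \<le> (\<Sum>i\<in>I. K ^ card I * x powr e * wpow (s i) d)"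
      proof (rule sum_mono)
        fix i assume i: "i \<in> I"
        have pc: "(\<Prod>j\<in>I - {i}. ?c d j) = K ^ (card I - 1) * (x powr ((real (card I) - 1) * (1 + \<epsilon>))
            * (\<Prod>j\<in>I - {i}. real (d j) powr (- (1 - \<epsilon>))))"
        proof -
          have "card I \<ge> 1" using i by (auto simp: Suc_le_eq card_gt_0_iff)
          then have "(x powr (1 + \<epsilon>)) ^ (card I - 1) = x powr ((real (card I) - 1) * (1 + \<epsilon>))"
            using x by (simp add: powr_realpow[symmetric] powr_powr of_nat_diff mult.commute)
          then show ?thesis using i by (simp add: prod.distrib)
        qed
        have "\<bar>?S d i - ?M d i\<bar> \<le> c i * (x powr a * real (d i) powr (- a))"
          using c_bounds[OF i y0] by (simp only: pw)
        also have "\<dots> \<le> K * (x powr a * real (d i) powr (- a))"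
          using cK[OF i] c[OF i] by (intro mult_right_mono) auto
        finally have "\<bar>?S d i - ?M d i\<bar> * (\<Prod>j\<in>I - {i}. ?c d j)
            \<le> K * (x powr a * real (d i) powr (- a)) * (\<Prod>j\<in>I - {i}. ?c d j)"
          using K0 by (intro mult_right_mono prod_nonneg) auto
        also have "\<dots> = (K * K ^ (card I - 1)) * (x powr a * x powr ((real (card I) - 1) * (1 + \<epsilon>)))
              * (real (d i) powr (- a) * (\<Prod>j\<in>I - {i}. real (d j) powr (- (1 - \<epsilon>))))"
          by (simp only: pc mult_ac)
        also have "K * K ^ (card I - 1) = K ^ card I"
          using i by (cases "card I") auto
        also have "x powr a * x powr ((real (card I) - 1) * (1 + \<epsilon>)) = x powr e"
          by (simp add: e_def powr_add)
        also have "real (d i) powr (- a) * (\<Prod>j\<in>I - {i}. real (d j) powr (- (1 - \<epsilon>))) = wpow (s i) d"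
          unfolding wpow_def using i by (subst prod.remove[of I i]) (auto simp: s_def intro!: prod.cong)
        finally show "\<bar>?S d i - ?M d i\<bar> * (\<Prod>j\<in>I - {i}. ?c d j) \<le> K ^ card I * x powr e * wpow (s i) d" .
      qed
      finally show ?thesis by (simp only: sum_distrib_left)
    qed
    have "coprime_sum x - x ^ card I * (\<Sum>k\<le>main_degree. ln x ^ k * main_coeff n k)
        = euler_sum exps h n (\<lambda>d. (\<Prod>i\<in>I. ?S d i) - (\<Prod>i\<in>I. ?M d i))"
      using coprime_sum_eq_euler_sum[OF n] euler_sum_main[of x n] x by (simp only: euler_sum_diff)
    then have "\<bar>coprime_sum x - x ^ card I * (\<Sum>k\<le>main_degree. ln x ^ k * main_coeff n k)\<bar>
        = \<bar>euler_sum exps h n (\<lambda>d. (\<Prod>i\<in>I. ?S d i) - (\<Prod>i\<in>I. ?M d i))\<bar>" by (rule arg_cong)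
    also have "\<dots> \<le> euler_sum exps (\<lambda>v. \<bar>h v\<bar>) n (\<lambda>d. K ^ card I * x powr e * (\<Sum>i\<in>I. wpow (s i) d))"
      by (rule abs_euler_sum_le) (rule pt)
    also have "\<dots> = K ^ card I * x powr e * (\<Sum>i\<in>I. euler_sum exps (\<lambda>v. \<bar>h v\<bar>) n (wpow (s i)))"
      by (simp only: euler_sum_scale euler_sum_sum)
    also have "\<dots> \<le> K ^ card I * x powr e * (\<Sum>i\<in>I. B i)"
      using K0 B by (intro mult_left_mono sum_mono) auto
    finally show ?thesis by (simp add: C_def mult_ac)
  qed
  \<comment> \<open>For fixed x the bound holds for all n > floor(x) with a constant free of n, so
    it passes to the limit of the coefficients.\<close>
  have "\<bar>coprime_sum x - x ^ card I * poly main_poly (ln x)\<bar> \<le> C * x powr e" if x: "x \<ge> 1" for x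
  proof (rule LIMSEQ_le_const2)
    have lim: "(\<lambda>n. main_coeff n k) \<longlonglongrightarrow> lim (\<lambda>n. main_coeff n k)" for k
      using convergent_main_coeff by (simp add: convergent_LIMSEQ_iff)
    have "poly main_poly (ln x) = (\<Sum>k\<le>main_degree. ln x ^ k * lim (\<lambda>n. main_coeff n k))"
      by (simp add: main_poly_def poly_sum poly_monom mult.commute)
    then show "(\<lambda>n. \<bar>coprime_sum x - x ^ card I * (\<Sum>k\<le>main_degree. ln x ^ k * main_coeff n k)\<bar>)
        \<longlonglongrightarrow> \<bar>coprime_sum x - x ^ card I * poly main_poly (ln x)\<bar>"
      by (auto intro!: tendsto_intros lim)
    show "\<exists>N. \<forall>n\<ge>N. \<bar>coprime_sum x - x ^ card I * (\<Sum>k\<le>main_degree. ln x ^ k * main_coeff n k)\<bar> \<le> C * x powr e"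
      using step[OF x] by (intro exI[of _ "Suc (nat \<lfloor>x\<rfloor>)"]) auto
  qed
  then show ?thesis unfolding e_def a_def by blast
qed

end

end

theorem theorem13:
  fixes r :: nat and t :: "nat \<Rightarrow> nat" and \<theta> :: "nat \<Rightarrow> real"
  assumes "r \<ge> 2"
    and "\<And>i. i \<in> {1..r} \<Longrightarrow> t i \<ge> 2"
    and "\<And>i. i \<in> {1..r} \<Longrightarrow> piltz_exponent (t i) (\<theta> i)"
  shows "convergent_prod (Delta_seq r t) \<and>
    (\<exists>Q :: real poly.
       degree Q = (\<Sum>i\<in>{1..r}. t i) - r \<and>
       lead_coeff Q = Delta r t / (\<Prod>i\<in>{1..r}. fact (t i - 1)) \<and>
       (\<forall>\<epsilon>>0. (\<lambda>x. (\<Sum>n\<in>coprime_tuples r x. \<Prod>i\<in>{1..r}. real (piltz (t i) (n i)))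
                     - x ^ r * poly Q (ln x))
               \<in> O[at_top](\<lambda>x. x powr (real r - 1 + Max (\<theta> ` {1..r}) + \<epsilon>))))"
proof -
  let ?I = "{1..r}"
  define \<Theta> where "\<Theta> = Max (\<theta> ` ?I)"
  interpret coprime_sieve ?I t "Max (t ` ?I)"
    by unfold_locales auto
  have Delta_seq: "Delta_seq r t = (\<lambda>p. if prime p then local_factor p else 1)"
    by (simp only: Delta_seq_def fun_eq_iff Delta_factor_eq_prods local_factor_eq prime_gt_0_nat cong: if_cong)
      simp
  have conv: "convergent_prod (Delta_seq r t)"
    unfolding Delta_seq by (rule convergent_prod_local_factor)
  have Delta: "Delta r t = (\<Prod>p. if prime p then local_factor p else 1)"
    by (simp add: Delta_def Delta_seq)
  then have Delta_nonzero: "Delta r t \<noteq> 0"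
    using prodinf_local_factor_nonzero by simp
  have sum_eq: "(\<Sum>n\<in>coprime_tuples r x. \<Prod>i\<in>?I. real (piltz (t i) (n i))) = coprime_sum x" for x
    by (simp only: coprime_tuples_def coprime_sum_def)
  \<comment> \<open>Subtraction is truncated on naturals; \<open>t i\<close> >= 1 makes the two
    sides agree.\<close>
  have deg: "(\<Sum>i\<in>?I. t i - 1) = (\<Sum>i\<in>?I. t i) - r"
  proof (subst sum_subtractf_nat)
    show "1 \<le> t i" if "i \<in> ?I" for i using assms(2)[OF that] by simp
  qed simp
  have \<theta>_le: "\<theta> i \<le> \<Theta>" if "i \<in> ?I" for i
    unfolding \<Theta>_def using that by (intro Max_ge) auto
  have "\<Theta> \<in> \<theta> ` ?I" unfolding \<Theta>_def using assms(1) by (intro Max_in) auto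
  then have \<Theta>0: "\<Theta> \<ge> 0"
    using piltz_exponent_nonneg[OF assms(3)] assms(2) by fastforce
  have "\<exists>Q. degree Q = (\<Sum>i\<in>?I. t i) - r \<and> lead_coeff Q = Delta r t / (\<Prod>i\<in>?I. fact (t i - 1)) \<and>
       (\<forall>\<epsilon>>0. (\<lambda>x. coprime_sum x - x ^ r * poly Q (ln x)) \<in> O[at_top](\<lambda>x. x powr (real r - 1 + \<Theta> + \<epsilon>)))"
  proof (cases "\<Theta> < 1")
    case True
    have "\<forall>i\<in>?I. \<exists>P :: real poly. degree P = t i - 1 \<and> lead_coeff P = 1 / fact (t i - 1) \<and>
       (\<forall>\<epsilon>>0. (\<lambda>x. piltz_sum (t i) (nat \<lfloor>x\<rfloor>) - x * poly P (ln x)) \<in> O[at_top](\<lambda>x. x powr (\<theta> i + \<epsilon>)))"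
      using assms(3) unfolding piltz_exponent_def piltz_sum_def by blast
    from bchoice[OF this] obtain P :: "nat \<Rightarrow> real poly" where
      "\<forall>i\<in>?I. degree (P i) = t i - 1 \<and> lead_coeff (P i) = 1 / fact (t i - 1) \<and>
       (\<forall>\<epsilon>>0. (\<lambda>x. piltz_sum (t i) (nat \<lfloor>x\<rfloor>) - x * poly (P i) (ln x)) \<in> O[at_top](\<lambda>x. x powr (\<theta> i + \<epsilon>)))"
      by (rule exE)
    then have P: "\<And>i. i \<in> ?I \<Longrightarrow> degree (P i) = t i - 1" "\<And>i. i \<in> ?I \<Longrightarrow> lead_coeff (P i) = 1 / fact (t i - 1)"
      and P_O: "\<And>i \<epsilon>. i \<in> ?I \<Longrightarrow> \<epsilon> > 0 \<Longrightarrow>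
        (\<lambda>x. piltz_sum (t i) (nat \<lfloor>x\<rfloor>) - x * poly (P i) (ln x)) \<in> O[at_top](\<lambda>x. x powr (\<theta> i + \<epsilon>))"
      by blast+
    have P0: "P i \<noteq> 0" if "i \<in> ?I" for i using P(2)[OF that] by auto
    have deg_P: "main_degree P = (\<Sum>i\<in>?I. t i) - r"
      unfolding deg[symmetric] using P(1) by (subst main_degree_def) (auto simp: P0)
    show ?thesis
    \<comment> \<open>The polynomials \<open>P i\<close> do not depend on \<epsilon>, so this
      witness is fixed before \<epsilon> is given.\<close>
    proof (intro exI[of _ "main_poly P"] conjI allI impI)
      show degree: "degree (main_poly P) = (\<Sum>i\<in>?I. t i) - r"
        using degree_main_poly[OF P0] deg_P by simp
      have "lead_coeff (main_poly P) = (\<Prod>i\<in>?I. lead_coeff (P i)) * Delta r t"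
        unfolding Delta by (rule lead_coeff_main_poly[OF P0])
      also have "(\<Prod>i\<in>?I. lead_coeff (P i)) = (\<Prod>i\<in>?I. 1 / fact (t i - 1))"
        using P(2) by (intro prod.cong refl) auto
      finally show "lead_coeff (main_poly P) = Delta r t / (\<Prod>i\<in>?I. fact (t i - 1))"
        by (simp add: prod_dividef)
    next
      fix \<epsilon> :: real assume \<epsilon>: "\<epsilon> > 0"
      \<comment> \<open>The final exponent exceeds r - 1 + \<Theta> by (r + 1)\<eta>, which must be
        at most \<epsilon>; the other two bounds meet the side conditions of the asymptotic
        estimate.\<close>
      define \<eta> where "\<eta> = min (\<epsilon> / (real r + 1)) (min ((1 - \<Theta>) / 3) (1 / 3))"
      have \<eta>: "\<eta> > 0" "\<eta> \<le> 1 / 3" "\<Theta> + 3 * \<eta> \<le> 1" "\<eta> \<le> \<epsilon> / (real r + 1)"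
      proof -
        have "\<eta> \<le> (1 - \<Theta>) / 3" unfolding \<eta>_def by (intro min.coboundedI2 min.cobounded1)
        then show "\<Theta> + 3 * \<eta> \<le> 1" by simp
        show "\<eta> \<le> 1 / 3" unfolding \<eta>_def by (intro min.coboundedI2 min.cobounded2)
      qed (use \<epsilon> True in \<open>simp_all add: \<eta>_def\<close>)
      \<comment> \<open>Choosing \<Theta> + 2\<eta> - \<theta> i > 0 as the small parameter brings
        all indices to one exponent.\<close>
      have O: "(\<lambda>x. piltz_sum (t i) (nat \<lfloor>x\<rfloor>) - x * poly (P i) (ln x)) \<in> O[at_top](\<lambda>x. x powr (\<Theta> + 2 * \<eta>))"
        if "i \<in> ?I" for i
        using P_O[OF that, of "\<Theta> + 2 * \<eta> - \<theta> i"] \<theta>_le[OF that] \<eta>(1) by simp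
      obtain C where C: "\<And>x. x \<ge> 1 \<Longrightarrow> \<bar>coprime_sum x - x ^ r * poly (main_poly P) (ln x)\<bar>
          \<le> C * x powr (\<Theta> + 2 * \<eta> + (real r - 1) * (1 + \<eta>))"
        using coprime_sum_asymptotics[OF P0 \<eta>(1,2) \<Theta>0 \<eta>(3) O] by auto
      have "(real r + 1) * \<eta> \<le> \<epsilon>" using \<eta>(4) by (simp add: field_simps)
      then have exponent: "\<Theta> + 2 * \<eta> + (real r - 1) * (1 + \<eta>) \<le> real r - 1 + \<Theta> + \<epsilon>"
        by (simp add: algebra_simps)
      show "(\<lambda>x. coprime_sum x - x ^ r * poly (main_poly P) (ln x)) \<in> O[at_top](\<lambda>x. x powr (real r - 1 + \<Theta> + \<epsilon>))"
      proof (rule bigoI[where c = "\<bar>C\<bar>"], rule eventually_mono[OF eventually_ge_at_top[of 1]])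
        fix x :: real assume x: "x \<ge> 1"
        have "\<bar>coprime_sum x - x ^ r * poly (main_poly P) (ln x)\<bar>
            \<le> C * x powr (\<Theta> + 2 * \<eta> + (real r - 1) * (1 + \<eta>))" by (rule C[OF x])
        also have "\<dots> \<le> \<bar>C\<bar> * x powr (real r - 1 + \<Theta> + \<epsilon>)"
          using x exponent by (intro mult_mono powr_mono) auto
        finally show "norm (coprime_sum x - x ^ r * poly (main_poly P) (ln x))
            \<le> \<bar>C\<bar> * norm (x powr (real r - 1 + \<Theta> + \<epsilon>))" by simp
      qed
    qed
  next
    case False
    define N where "N = (\<Sum>i\<in>?I. t i) - r"
    \<comment> \<open>Any polynomial with the prescribed degree and leading coefficient will do
      here, and a monomial has both because \<open>Delta r t\<close> is nonzero.\<close>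
    define Q where "Q = monom (Delta r t / (\<Prod>i\<in>?I. fact (t i - 1))) N"
    have Q: "degree Q = N" "lead_coeff Q = Delta r t / (\<Prod>i\<in>?I. fact (t i - 1))"
      using Delta_nonzero by (simp_all add: Q_def degree_monom_eq lead_coeff_monom)
    show ?thesis
    proof (intro exI[of _ Q] conjI allI impI)
      show "degree Q = (\<Sum>i\<in>?I. t i) - r" using Q by (simp add: N_def)
      show "lead_coeff Q = Delta r t / (\<Prod>i\<in>?I. fact (t i - 1))" by (rule Q)
      fix \<epsilon> :: real assume \<epsilon>: "\<epsilon> > 0"
      \<comment> \<open>The r factors x^(1+\<eta>) multiply to x^(r+\<epsilon>), within the error
        term since \<Theta> >= 1.\<close>
      define \<eta> where "\<eta> = \<epsilon> / real r"
      have \<eta>: "\<eta> > 0" using \<epsilon> assms(1) by (simp add: \<eta>_def)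
      have "\<forall>i. \<exists>C. C \<ge> 0 \<and> (\<forall>y\<ge>0. piltz_sum (t i) (nat \<lfloor>y\<rfloor>) \<le> C * y powr (1 + \<eta>))"
        using piltz_sum_floor_bound[OF \<eta>] by metis
      from choice[OF this] obtain c where
        "\<forall>i. c i \<ge> 0 \<and> (\<forall>y\<ge>0. piltz_sum (t i) (nat \<lfloor>y\<rfloor>) \<le> c i * y powr (1 + \<eta>))"
        by (rule exE)
      then have c: "\<And>i. c i \<ge> 0"
        "\<And>i y. y \<ge> 0 \<Longrightarrow> piltz_sum (t i) (nat \<lfloor>y\<rfloor>) \<le> c i * y powr (1 + \<eta>)"
        by blast+
      obtain D where D: "D \<ge> 0" "\<And>u. \<bar>poly Q u\<bar> \<le> D * exp (\<epsilon> * \<bar>u\<bar>)"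
        using poly_le_exp[OF \<epsilon>] by blast
      show "(\<lambda>x. coprime_sum x - x ^ r * poly Q (ln x)) \<in> O[at_top](\<lambda>x. x powr (real r - 1 + \<Theta> + \<epsilon>))"
      proof (rule bigoI[where c = "(\<Prod>i\<in>?I. c i) + D"], rule eventually_mono[OF eventually_ge_at_top[of 1]])
        fix x :: real assume x: "x \<ge> 1"
        have "coprime_sum x \<le> (\<Prod>i\<in>?I. c i * x powr (1 + \<eta>))"
          by (rule order_trans[OF coprime_sum_le prod_mono]) (use c x in \<open>auto simp: piltz_sum_nonneg\<close>)
        also have "\<dots> = (\<Prod>i\<in>?I. c i) * x powr (real r + \<epsilon>)"
        proof -
          have "(1 + \<eta>) * real r = real r + \<epsilon>" using assms(1) by (simp add: \<eta>_def distrib_right)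
          then have "(x powr (1 + \<eta>)) ^ r = x powr (real r + \<epsilon>)"
            using x by (simp add: powr_realpow[symmetric] powr_powr)
          then show ?thesis by (simp add: prod.distrib)
        qed
        finally have 1: "coprime_sum x \<le> (\<Prod>i\<in>?I. c i) * x powr (real r + \<epsilon>)" .
        have "\<bar>x ^ r * poly Q (ln x)\<bar> \<le> x ^ r * (D * exp (\<epsilon> * \<bar>ln x\<bar>))"
          unfolding abs_mult using x D(1) by (intro mult_mono D(2)) auto
        also have "\<dots> = D * x powr (real r + \<epsilon>)"
          using x by (simp add: powr_add powr_realpow) (simp add: powr_def)
        finally have 2: "\<bar>x ^ r * poly Q (ln x)\<bar> \<le> D * x powr (real r + \<epsilon>)" .
        have "\<bar>coprime_sum x - x ^ r * poly Q (ln x)\<bar> \<le> ((\<Prod>i\<in>?I. c i) + D) * x powr (real r + \<epsilon>)"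
          using 1 2 coprime_sum_nonneg[of x] by (simp add: distrib_right abs_le_iff)
        also have "\<dots> \<le> ((\<Prod>i\<in>?I. c i) + D) * x powr (real r - 1 + \<Theta> + \<epsilon>)"
          using x False c D by (intro mult_left_mono powr_mono add_nonneg_nonneg prod_nonneg) auto
        finally show "norm (coprime_sum x - x ^ r * poly Q (ln x))
            \<le> ((\<Prod>i\<in>?I. c i) + D) * norm (x powr (real r - 1 + \<Theta> + \<epsilon>))" by simp
      qed
    qed
  qed
  with conv show ?thesis unfolding sum_eq \<Theta>_def[symmetric] by (rule conjI)
qed

end
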